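(* Let $\mathcal{D}$ be a probability distribution on $\mathbb{R}$ with mean $\varphi\in\mathbb{R}$, variance $\psi^2\ge 0$, and finite fifth moment. For each $n$, let $M$ be a random symmetric $n\times n$ matrix with $M_{ii}=1$ for all $i\in[n]$, and where the entries $M_{ij}$, $i<j$, are sampled independently as follows: with probability $1/2$, $M_{ij}=1$, and with probability $1/2$, $M_{ij}$ is drawn from $\mathcal{D}$ (and $M_{ji}=M_{ij}$). Then for every constant $\varepsilon>0$, for all $n$ large enough, $\lambda_1(M)\ge (2-\varepsilon)\sqrt{n}$ with high probability (i.e., with probability tending to $1$ as $n\to\infty$).
   Context: $\lambda_1(M)$ denotes the largest eigenvalue of the symmetric matrix $M$. *)

theory Defs
  imports "HOL-Probability.Probability" "Jordan_Normal_Form.Char_Poly"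
begin

definition lambda1 :: "real mat \<Rightarrow> real" where
  "lambda1 A = Max {k. eigenvalue A k}"

definition entry_dist :: "real measure \<Rightarrow> real measure" where
  "entry_dist D = measure_pmf (bernoulli_pmf (1/2)) \<bind> (\<lambda>b. if b then return D 1 else D)"

definition upper_idx :: "nat \<Rightarrow> (nat \<times> nat) set" where
  "upper_idx n = {(i, j). i < j \<and> j < n}"

definition entries_space :: "real measure \<Rightarrow> nat \<Rightarrow> ((nat \<times> nat) \<Rightarrow> real) measure" where
  "entries_space D n = PiM (upper_idx n) (\<lambda>_. entry_dist D)"

definition rand_mat :: "nat \<Rightarrow> ((nat \<times> nat) \<Rightarrow> real) \<Rightarrow> real mat" where
  "rand_mat n \<omega> = mat n n (\<lambda>(i, j). if i = j then 1 else if i < j then \<omega> (i, j) else \<omega> (j, i))"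

end

theory Submission
  imports Defs "Jordan_Normal_Form.Spectral_Radius" "HOL-Real_Asymp.Real_Asymp"
begin

text \<open>
  Let \<open>m = (1 + \<phi>) / 2\<close> and \<open>s\<^sup>2 = \<psi>\<^sup>2 / 2 + ((1 - \<phi>) / 2)\<^sup>2\<close> be the mean and variance of an off-diagonal entry.
  If \<open>m > 0\<close>, the Rayleigh quotient of the all-ones vector is of order \<open>n\<close> by Chebyshev's inequality.
  Otherwise \<open>\<phi> \<le> -1\<close> and hence \<open>s \<ge> 1\<close>. Suppose then that all eigenvalues of \<open>M\<close> are below
  \<open>(2 - \<epsilon>) sqrt n\<close>. At the real point \<open>T = (2 - \<epsilon>/2) sqrt n\<close> the resolvent \<open>G = 1 / (T - M)\<close> is positive
  definite with norm at most \<open>2 / (\<epsilon> sqrt n)\<close>, and so is the resolvent \<open>H\<^sub>i\<close> of \<open>M\<close> with row and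
  column \<open>i\<close> cleared, which is independent of row \<open>i\<close>. The inequality \<open>G\<^sub>i\<^sub>i \<ge> 2 x\<^sub>i - x\<^sup>T (T - M) x\<close>
  with \<open>x = a (e\<^sub>i + H\<^sub>i \<xi>)\<close>, \<open>\<xi>\<close> the centred row \<open>i\<close>, gives
  \<open>G\<^sub>i\<^sub>i \<ge> 2 a - a\<^sup>2 (T - s\<^sup>2 tr G + O(1))\<close> on average over \<open>i\<close>, because the quadratic form \<open>\<xi>\<^sup>T H\<^sub>i \<xi>\<close>
  has bounded variance. Summing over \<open>i\<close> with \<open>a = tr G / n\<close> yields
  \<open>n \<le> tr G (T - s\<^sup>2 tr G + o(sqrt n)) \<le> (T + o(sqrt n))\<^sup>2 / (4 s\<^sup>2)\<close>, which contradicts \<open>T < 2 s sqrt n\<close>.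
\<close>

section \<open>Quadratic forms and the largest eigenvalue\<close>

text \<open>Vectors and matrices are total functions of which only the values at indices below
  \<open>n\<close> count. This avoids carrier conditions; \<open>mat_of\<close> links to the matrix
  type where determinants and eigenvalues are needed.\<close>

definition dotp :: "nat \<Rightarrow> (nat \<Rightarrow> real) \<Rightarrow> (nat \<Rightarrow> real) \<Rightarrow> real" where
  "dotp n x y = (\<Sum>i<n. x i * y i)"

definition mulv :: "nat \<Rightarrow> (nat \<Rightarrow> nat \<Rightarrow> real) \<Rightarrow> (nat \<Rightarrow> real) \<Rightarrow> nat \<Rightarrow> real" where
  "mulv n A x i = (\<Sum>j<n. A i j * x j)"

definition quad :: "nat \<Rightarrow> (nat \<Rightarrow> nat \<Rightarrow> real) \<Rightarrow> (nat \<Rightarrow> real) \<Rightarrow> real" where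
  "quad n A x = dotp n x (mulv n A x)"

definition symm :: "nat \<Rightarrow> (nat \<Rightarrow> nat \<Rightarrow> real) \<Rightarrow> bool" where
  "symm n A \<longleftrightarrow> (\<forall>i<n. \<forall>j<n. A i j = A j i)"

definition mat_of :: "nat \<Rightarrow> (nat \<Rightarrow> nat \<Rightarrow> real) \<Rightarrow> real mat" where
  "mat_of n A = mat n n (\<lambda>(i, j). A i j)"

lemma dotp_comm: "dotp n x y = dotp n y x"
  by (simp add: dotp_def mult.commute)

lemma dotp_add_right: "dotp n x (\<lambda>i. y i + z i) = dotp n x y + dotp n x z"
  by (simp add: dotp_def algebra_simps sum.distrib)

lemma dotp_scale_right: "dotp n x (\<lambda>i. c * y i) = c * dotp n x y"
  by (simp add: dotp_def sum_distrib_left algebra_simps)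

lemma dotp_add_left: "dotp n (\<lambda>i. y i + z i) x = dotp n y x + dotp n z x"
  by (simp add: dotp_def algebra_simps sum.distrib)

lemma dotp_scale_left: "dotp n (\<lambda>i. c * y i) x = c * dotp n y x"
  by (simp add: dotp_def sum_distrib_left algebra_simps)

lemma dotp_nonneg: "0 \<le> dotp n x x"
  by (simp add: dotp_def sum_nonneg)

lemma dotp_cong: "(\<And>i. i < n \<Longrightarrow> x i = x' i) \<Longrightarrow> (\<And>i. i < n \<Longrightarrow> y i = y' i) \<Longrightarrow> dotp n x y = dotp n x' y'"
  by (simp add: dotp_def)

lemma dotp_eq_0_iff: "dotp n x x = 0 \<longleftrightarrow> (\<forall>i<n. x i = 0)"
  by (auto simp add: dotp_def sum_nonneg_eq_0_iff)

lemma mulv_add: "mulv n A (\<lambda>i. x i + y i) = (\<lambda>i. mulv n A x i + mulv n A y i)"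
  by (rule ext) (simp add: mulv_def algebra_simps sum.distrib)

lemma mulv_scale: "mulv n A (\<lambda>i. c * x i) = (\<lambda>i. c * mulv n A x i)"
  by (rule ext) (simp add: mulv_def sum_distrib_left algebra_simps)

lemma mulv_cong: "(\<And>i. i < n \<Longrightarrow> x i = y i) \<Longrightarrow> mulv n A x = mulv n A y"
  by (rule ext) (simp add: mulv_def)

lemma quad_cong: "(\<And>i. i < n \<Longrightarrow> x i = y i) \<Longrightarrow> quad n A x = quad n A y"
  unfolding quad_def by (rule dotp_cong) (auto simp: mulv_cong[of n x y])

lemma dotp_mulv_symm:
  assumes "symm n A"
  shows "dotp n x (mulv n A y) = dotp n y (mulv n A x)"
proof -
  have "dotp n x (mulv n A y) = (\<Sum>i<n. \<Sum>j<n. A i j * x i * y j)"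
    by (simp add: dotp_def mulv_def sum_distrib_left algebra_simps)
  also have "\<dots> = (\<Sum>j<n. \<Sum>i<n. A i j * x i * y j)"
    by (rule sum.swap)
  also have "\<dots> = (\<Sum>j<n. \<Sum>i<n. A j i * x i * y j)"
    using assms by (intro sum.cong refl) (auto simp: symm_def)
  also have "\<dots> = dotp n y (mulv n A x)"
    by (simp add: dotp_def mulv_def sum_distrib_left algebra_simps)
  finally show ?thesis .
qed

lemma quad_add:
  assumes "symm n A"
  shows "quad n A (\<lambda>i. x i + t * y i) = quad n A x + 2 * t * dotp n y (mulv n A x) + t\<^sup>2 * quad n A y"
  using dotp_mulv_symm[OF assms, of x y]
  by (simp add: quad_def mulv_add mulv_scale dotp_add_right dotp_add_left dotp_scale_right
      dotp_scale_left algebra_simps power2_eq_square)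

lemma quad_scale: "quad n A (\<lambda>i. c * x i) = c\<^sup>2 * quad n A x"
  by (simp add: quad_def mulv_scale dotp_scale_right dotp_scale_left power2_eq_square)

text \<open>At \<open>t = - b / d\<close> with \<open>d = \<bar>c\<bar> + 1\<close> the expression
  is at most \<open>- (b\<^sup>2 / d)\<close>, which is negative unless \<open>b = 0\<close>. The
  summand 1 keeps \<open>d\<close> positive when \<open>c = 0\<close>.\<close>

lemma linear_coeff_zero:
  fixes b c :: real
  assumes "\<And>t. 0 \<le> 2 * t * b + t\<^sup>2 * c"
  shows "b = 0"
proof (rule ccontr)
  assume b: "b \<noteq> 0"
  define d where "d = \<bar>c\<bar> + 1"
  define t where "t = - b / d"
  have d: "d > 0" by (simp add: d_def)
  have "2 * t * b + t\<^sup>2 * c \<le> 2 * t * b + t\<^sup>2 * d"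
    unfolding d_def by (intro add_left_mono mult_left_mono) auto
  also have "\<dots> = - (b\<^sup>2 / d)"
    unfolding t_def using d by (simp add: field_simps power2_eq_square)
  also have "\<dots> < 0" using b d by simp
  finally show False using assms[of t] by simp
qed

text \<open>Moving from the null vector in the direction \<open>A x\<close> gives a nonnegative
  polynomial in \<open>t\<close> without constant term, so its linear coefficient, twice the squared
  norm of \<open>A x\<close>, vanishes.\<close>

lemma psd_null_vector:
  assumes "symm n A" and psd: "\<And>x. 0 \<le> quad n A x" and "quad n A x = 0" and "i < n"
  shows "mulv n A x i = 0"
proof -
  have "dotp n (mulv n A x) (mulv n A x) = 0"
  proof (rule linear_coeff_zero)
    fix t
    show "0 \<le> 2 * t * dotp n (mulv n A x) (mulv n A x) + t\<^sup>2 * quad n A (mulv n A x)"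
      using psd[of "\<lambda>i. x i + t * mulv n A x i"] quad_add[OF assms(1), of x t "mulv n A x"] assms(3)
      by simp
  qed
  then show ?thesis using assms(4) by (auto simp: dotp_eq_0_iff)
qed

text \<open>This is \<open>T I - B\<close>, whose inverse is the resolvent of \<open>B\<close> at
  \<open>T\<close>.\<close>

definition shifted :: "real \<Rightarrow> (nat \<Rightarrow> nat \<Rightarrow> real) \<Rightarrow> nat \<Rightarrow> nat \<Rightarrow> real" where
  "shifted T B i j = (if i = j then T else 0) - B i j"

lemma mulv_shifted:
  assumes "i < n"
  shows "mulv n (shifted c A) x i = c * x i - mulv n A x i"
proof -
  have "(\<Sum>j<n. (if i = j then c else 0) * x j) = c * x i"
    using assms by (simp add: if_distrib[of "\<lambda>z. z * _"] cong: if_cong)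
  then show ?thesis by (simp add: mulv_def shifted_def algebra_simps sum_subtractf)
qed

lemma quad_shifted:
  "quad n (shifted c A) x = c * dotp n x x - quad n A x"
proof -
  have "quad n (shifted c A) x = dotp n x (\<lambda>i. c * x i - mulv n A x i)"
    unfolding quad_def by (rule dotp_cong) (auto simp: mulv_shifted)
  also have "\<dots> = c * dotp n x x - quad n A x"
    by (simp add: quad_def dotp_def algebra_simps sum_subtractf sum_distrib_left)
  finally show ?thesis .
qed

lemma symm_shifted: "symm n A \<Longrightarrow> symm n (shifted c A)"
  by (auto simp: symm_def shifted_def)

section \<open>The largest eigenvalue as the maximum of the quadratic form\<close>

lemma continuous_on_quad: "continuous_on S (quad n A)"
  unfolding quad_def dotp_def mulv_def
  by (intro continuous_intros continuous_on_subset[OF continuous_on_product_coordinates subset_UNIV])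

lemma continuous_on_dotp: "continuous_on S (\<lambda>x. dotp n x x)"
  unfolding dotp_def
  by (intro continuous_intros continuous_on_subset[OF continuous_on_product_coordinates subset_UNIV])

text \<open>Setting the coordinates from \<open>n\<close> on to 0 makes the sphere a closed subset
  of a product of compact sets, so Tychonoff's theorem applies in the function space.\<close>

lemma compact_unit_sphere:
  "compact {x::nat \<Rightarrow> real. dotp n x x = 1 \<and> (\<forall>i\<ge>n. x i = 0)}" (is "compact ?S")
proof -
  let ?B = "PiE UNIV (\<lambda>i::nat. if i < n then {-1..1::real} else {0})"
  have "compactin (product_topology (\<lambda>i. euclidean) UNIV) ?B"
    by (subst compactin_PiE) auto
  then have B: "compact ?B"
    by (simp add: euclidean_product_topology)
  have "closed ((\<lambda>x::nat\<Rightarrow>real. dotp n x x) -` {1})"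
    by (intro continuous_closed_vimage) (auto intro: continuous_on_interior continuous_on_dotp[of UNIV])
  then have "compact (?B \<inter> (\<lambda>x. dotp n x x) -` {1})"
    by (rule compact_Int_closed[OF B])
  moreover have "?B \<inter> (\<lambda>x. dotp n x x) -` {1} = ?S"
  proof (intro antisym subsetI)
    fix x :: "nat \<Rightarrow> real"
    assume x: "x \<in> ?S"
    have "x i \<in> {-1..1}" if "i < n" for i
    proof -
      have "x i * x i \<le> dotp n x x"
        unfolding dotp_def using that by (intro member_le_sum) auto
      then have "(x i)\<^sup>2 \<le> 1" using x by (simp add: power2_eq_square)
      then have "\<bar>x i\<bar> \<le> 1" by (simp add: abs_square_le_1)
      then show ?thesis by auto
    qed
    then show "x \<in> ?B \<inter> (\<lambda>x. dotp n x x) -` {1}" using x by auto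
  qed (auto simp: PiE_def Pi_def split: if_splits, metis leD)
  ultimately show ?thesis by simp
qed

lemma eigenvalue_mat_of_iff:
  "eigenvalue (mat_of n A) k \<longleftrightarrow>
    (\<exists>x. (\<exists>i<n. x i \<noteq> 0) \<and> (\<forall>i<n. mulv n A x i = k * x i))"
proof
  assume "eigenvalue (mat_of n A) k"
  then obtain v where v: "v \<in> carrier_vec n" "v \<noteq> 0\<^sub>v n" "mat_of n A *\<^sub>v v = k \<cdot>\<^sub>v v"
    unfolding eigenvalue_def eigenvector_def by (auto simp: mat_of_def)
  have "\<exists>i<n. vec_index v i \<noteq> 0" using v(1,2) by (metis carrier_vecD eq_vecI index_zero_vec(1,2))
  moreover have "mulv n A (\<lambda>i. vec_index v i) i = k * vec_index v i" if "i < n" for i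
  proof -
    have "vec_index (mat_of n A *\<^sub>v v) i = mulv n A (\<lambda>i. vec_index v i) i"
      using that v(1) by (auto simp: mat_of_def mulv_def scalar_prod_def lessThan_atLeast0 intro!: sum.cong)
    then show ?thesis using v that by simp
  qed
  ultimately show "\<exists>x. (\<exists>i<n. x i \<noteq> 0) \<and> (\<forall>i<n. mulv n A x i = k * x i)" by blast
next
  assume "\<exists>x. (\<exists>i<n. x i \<noteq> 0) \<and> (\<forall>i<n. mulv n A x i = k * x i)"
  then obtain x where x: "\<exists>i<n. x i \<noteq> 0" "\<forall>i<n. mulv n A x i = k * x i" by blast
  have "eigenvector (mat_of n A) (Matrix.vec n x) k"
    unfolding eigenvector_def
  proof (intro conjI)
    show "Matrix.vec n x \<noteq> 0\<^sub>v (dim_row (mat_of n A))"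
      using x(1) by (auto simp: mat_of_def) (metis index_vec index_zero_vec(1))
    show "mat_of n A *\<^sub>v Matrix.vec n x = k \<cdot>\<^sub>v Matrix.vec n x"
      using x(2) by (intro eq_vecI)
        (auto simp: mat_of_def mulv_def scalar_prod_def lessThan_atLeast0 intro!: sum.cong)
  qed (auto simp: mat_of_def)
  then show "eigenvalue (mat_of n A) k" by (auto simp: eigenvalue_def)
qed

text \<open>Let \<open>v\<close> maximise the form on the unit sphere, with value \<open>k\<close>.
  Then \<open>k I - A\<close> is positive semidefinite and its form vanishes at \<open>v\<close>, so
  \<open>v\<close> is a null vector of it, that is, an eigenvector of \<open>A\<close>.\<close>

lemma ex_top_eigenvalue:
  assumes "symm n A" "n > 0"
  shows "\<exists>k. eigenvalue (mat_of n A) k \<and> (\<forall>x. quad n A x \<le> k * dotp n x x)"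
proof -
  let ?S = "{x::nat \<Rightarrow> real. dotp n x x = 1 \<and> (\<forall>i\<ge>n. x i = 0)}"
  have "(\<lambda>i. if i = 0 then 1 else 0) \<in> ?S"
    using assms(2) by (auto simp: dotp_def if_distrib[of "\<lambda>z. z * _"] cong: if_cong)
  then have "?S \<noteq> {}" by blast
  from continuous_attains_sup[OF compact_unit_sphere this continuous_on_quad[of _ n A]]
  obtain v where v: "v \<in> ?S" and max: "\<And>y. y \<in> ?S \<Longrightarrow> quad n A y \<le> quad n A v" by blast
  define k where "k = quad n A v"
  have bound: "quad n A x \<le> k * dotp n x x" for x
  proof (cases "dotp n x x = 0")
    case True
    then have "quad n A x = 0"
      unfolding quad_def dotp_def[of n x "mulv n A x"] by (intro sum.neutral) (auto simp: dotp_eq_0_iff)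
    then show ?thesis using True by simp
  next
    case False
    then have pos: "dotp n x x > 0" using dotp_nonneg[of n x] by simp
    \<comment> \<open>Normalising moves \<open>x\<close> to the sphere; the truncation is required
      by the sphere's condition on coordinates from \<open>n\<close> on and does not change the
      form.\<close>
    define y where "y = (\<lambda>i. (1 / sqrt (dotp n x x)) * (if i < n then x i else 0))"
    have "dotp n y y = (1 / dotp n x x) * dotp n (\<lambda>i. if i < n then x i else 0) (\<lambda>i. if i < n then x i else 0)"
      unfolding y_def dotp_scale_left dotp_scale_right using pos by (simp add: field_simps)
    also have "dotp n (\<lambda>i. if i < n then x i else 0) (\<lambda>i. if i < n then x i else 0) = dotp n x x"
      by (rule dotp_cong) auto
    finally have "y \<in> ?S" using pos by (auto simp: y_def)
    then have "quad n A y \<le> k" using max by (simp add: k_def)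
    moreover have "quad n A y = (1 / dotp n x x) * quad n A x"
      using pos quad_cong[of n "\<lambda>i. if i < n then x i else 0" x A]
      unfolding y_def quad_scale by (simp add: power_divide)
    ultimately show ?thesis using pos by (simp add: field_simps)
  qed
  have "mulv n (shifted k A) v i = 0" if "i < n" for i
  proof (rule psd_null_vector[OF symm_shifted[OF assms(1)] _ _ that])
    show "0 \<le> quad n (shifted k A) x" for x
      using bound[of x] by (simp add: quad_shifted)
    show "quad n (shifted k A) v = 0"
      using v by (simp add: quad_shifted k_def)
  qed
  then have "\<forall>i<n. mulv n A v i = k * v i" by (simp add: mulv_shifted)
  moreover have "\<exists>i<n. v i \<noteq> 0" using v dotp_eq_0_iff[of n v] by auto
  ultimately have "eigenvalue (mat_of n A) k" unfolding eigenvalue_mat_of_iff by blast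
  with bound show ?thesis by blast
qed

text \<open>An eigenvector shows that any upper bound of the Rayleigh quotient bounds every
  eigenvalue. Hence the eigenvalue of \<open>ex_top_eigenvalue\<close> is the maximum of the finite
  spectrum.\<close>

lemma lambda1_le_iff:
  assumes "symm n A" "n > 0"
  shows "lambda1 (mat_of n A) \<le> c \<longleftrightarrow> (\<forall>x. quad n A x \<le> c * dotp n x x)"
proof -
  obtain k where k: "eigenvalue (mat_of n A) k" "\<And>x. quad n A x \<le> k * dotp n x x"
    using ex_top_eigenvalue[OF assms] by blast
  have le: "k' \<le> c" if c: "\<And>x. quad n A x \<le> c * dotp n x x" and "eigenvalue (mat_of n A) k'" for k' c
  proof -
    obtain x where x: "\<exists>i<n. x i \<noteq> 0" "\<forall>i<n. mulv n A x i = k' * x i"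
      using \<open>eigenvalue (mat_of n A) k'\<close> unfolding eigenvalue_mat_of_iff by blast
    have "quad n A x = dotp n x (\<lambda>i. k' * x i)"
      unfolding quad_def using x(2) by (intro dotp_cong) auto
    then have "k' * dotp n x x \<le> c * dotp n x x" using c[of x] by (simp add: dotp_scale_right)
    moreover have "dotp n x x > 0" using x(1) dotp_nonneg[of n x] dotp_eq_0_iff[of n x]
      by (metis less_eq_real_def)
    ultimately show ?thesis by simp
  qed
  have "finite {k. eigenvalue (mat_of n A) k}"
    using card_finite_spectrum(1)[of "mat_of n A" n] by (simp add: spectrum_def mat_of_def)
  then have "lambda1 (mat_of n A) = k"
    unfolding lambda1_def using k le[OF k(2)] by (intro Max_eqI) auto
  moreover have "quad n A x \<le> c * dotp n x x" if "k \<le> c" for x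
    using k(2)[of x] mult_right_mono[OF that dotp_nonneg[of n x]] by linarith
  ultimately show ?thesis using le[OF _ k(1)] by auto
qed

section \<open>Inverses of positive definite matrices\<close>

text \<open>Cramer's rule makes the inverse a measurable function of the entries.\<close>

definition inv_entry :: "nat \<Rightarrow> (nat \<Rightarrow> nat \<Rightarrow> real) \<Rightarrow> nat \<Rightarrow> nat \<Rightarrow> real" where
  "inv_entry n A i j = adj_mat (mat_of n A) $$ (i, j) / Determinant.det (mat_of n A)"

definition unit :: "nat \<Rightarrow> nat \<Rightarrow> real" where
  "unit k i = (if i = k then 1 else 0)"

lemma dotp_unit: "k < n \<Longrightarrow> dotp n (unit k) x = x k"
  by (simp add: dotp_def unit_def if_distrib[of "\<lambda>z. z * _"] cong: if_cong)

lemma mulv_unit: "k < n \<Longrightarrow> mulv n A (unit k) i = A i k"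
  by (simp add: mulv_def unit_def if_distrib[of "\<lambda>z. _ * z"] cong: if_cong)

text \<open>The lower bound \<open>c\<close> on the spectrum is explicit because
  \<open>1 / c\<close> bounds the norm of the inverse \<open>G\<close>.\<close>

locale pos_def_matrix =
  fixes n :: nat and A :: "nat \<Rightarrow> nat \<Rightarrow> real" and c :: real
  assumes symm: "symm n A" and c_pos: "c > 0"
    and lower: "\<And>x. c * dotp n x x \<le> quad n A x"
begin

abbreviation G :: "nat \<Rightarrow> nat \<Rightarrow> real" where "G \<equiv> inv_entry n A"

lemma quad_nonneg: "0 \<le> quad n A x"
  using lower[of x] c_pos dotp_nonneg[of n x] by (meson mult_nonneg_nonneg less_imp_le order_trans)

lemma det_nonzero: "Determinant.det (mat_of n A) \<noteq> 0"
proof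
  assume "Determinant.det (mat_of n A) = 0"
  then obtain v where v: "v \<in> carrier_vec n" "v \<noteq> 0\<^sub>v n" "mat_of n A *\<^sub>v v = 0\<^sub>v n"
    using det_0_iff_vec_prod_zero[of "mat_of n A" n] by (auto simp: mat_of_def)
  then have "mat_of n A *\<^sub>v v = 0 \<cdot>\<^sub>v v" by auto
  then have "eigenvalue (mat_of n A) 0"
    using v unfolding eigenvalue_def eigenvector_def by (auto simp: mat_of_def)
  then obtain x where x: "\<exists>i<n. x i \<noteq> 0" "\<forall>i<n. mulv n A x i = 0"
    unfolding eigenvalue_mat_of_iff by auto
  have "quad n A x = 0" unfolding quad_def dotp_def using x(2) by simp
  with lower[of x] c_pos have "dotp n x x \<le> 0" by (simp add: mult_le_0_iff)
  with dotp_nonneg[of n x] have "dotp n x x = 0" by simp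
  with x(1) show False by (auto simp: dotp_eq_0_iff)
qed

lemma mult_inverse:
  assumes "i < n" "j < n"
  shows "(\<Sum>k<n. A i k * G k j) = (if i = j then 1 else 0)"
proof -
  have M: "mat_of n A \<in> carrier_mat n n" by (simp add: mat_of_def)
  have "(mat_of n A * adj_mat (mat_of n A)) $$ (i, j) = (Determinant.det (mat_of n A) \<cdot>\<^sub>m 1\<^sub>m n) $$ (i, j)"
    using adj_mat(2)[OF M] by simp
  moreover have "(mat_of n A * adj_mat (mat_of n A)) $$ (i, j) = (\<Sum>k<n. A i k * adj_mat (mat_of n A) $$ (k, j))"
    using assms adj_mat(1)[OF M]
    by (auto simp: mat_of_def times_mat_def scalar_prod_def lessThan_atLeast0 intro!: sum.cong)
  ultimately have "(\<Sum>k<n. A i k * adj_mat (mat_of n A) $$ (k, j)) = Determinant.det (mat_of n A) * (if i = j then 1 else 0)"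
    using assms by simp
  then show ?thesis
    using det_nonzero by (simp add: inv_entry_def flip: sum_divide_distrib) 
qed

lemma mulv_inverse_col: "i < n \<Longrightarrow> j < n \<Longrightarrow> mulv n A (\<lambda>k. G k j) i = unit j i"
  using mult_inverse[of i j] by (simp add: mulv_def unit_def)

lemma mulv_inverse:
  assumes "i < n"
  shows "mulv n A (mulv n G x) i = x i"
proof -
  have "mulv n A (mulv n G x) i = (\<Sum>k<n. \<Sum>j<n. A i k * G k j * x j)"
    by (simp add: mulv_def sum_distrib_left algebra_simps)
  also have "\<dots> = (\<Sum>j<n. \<Sum>k<n. A i k * G k j * x j)" by (rule sum.swap)
  also have "\<dots> = (\<Sum>j<n. (if i = j then 1 else 0) * x j)"
    using assms by (intro sum.cong refl) (simp add: mult_inverse flip: sum_distrib_right)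
  also have "\<dots> = x i" using assms by (simp add: if_distrib[of "\<lambda>z. z * _"] cong: if_cong)
  finally show ?thesis .
qed

text \<open>The bilinear form of \<open>A\<close> at columns \<open>k\<close> and \<open>j\<close>
  of \<open>G\<close> equals \<open>G j k\<close> or \<open>G k j\<close>, depending on the column
  to which \<open>A\<close> is applied.\<close>

lemma symm_inverse: "symm n G"
  unfolding symm_def
proof (intro allI impI)
  fix k j assume kj: "k < n" "j < n"
  have "dotp n (\<lambda>i. G i k) (mulv n A (\<lambda>i. G i j)) = dotp n (\<lambda>i. G i k) (unit j)"
    using kj by (intro dotp_cong) (auto simp: mulv_inverse_col)
  moreover have "dotp n (\<lambda>i. G i j) (mulv n A (\<lambda>i. G i k)) = dotp n (\<lambda>i. G i j) (unit k)"
    using kj by (intro dotp_cong) (auto simp: mulv_inverse_col)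
  ultimately show "G k j = G j k"
    using dotp_mulv_symm[OF symm, of "\<lambda>i. G i k" "\<lambda>i. G i j"] kj
    by (simp add: dotp_comm[of n _ "unit _"] dotp_unit)
qed

lemma quad_mulv_inverse: "quad n A (mulv n G x) = quad n G x"
proof -
  have "quad n A (mulv n G x) = dotp n (mulv n G x) x"
    unfolding quad_def by (intro dotp_cong) (auto simp: mulv_inverse)
  then show ?thesis by (simp add: quad_def dotp_comm)
qed

text \<open>For \<open>y = G x\<close> the lower bound gives \<open>c |y|^2 <= <x, y>\<close>.
  Expanding \<open>|x - c y|^2 >= 0\<close> then takes the place of the Cauchy-Schwarz
  inequality.\<close>

lemma mulv_inverse_norm: "c\<^sup>2 * dotp n (mulv n G x) (mulv n G x) \<le> dotp n x x"
proof -
  let ?y = "mulv n G x"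
  have "0 \<le> dotp n (\<lambda>i. x i + (-c) * ?y i) (\<lambda>i. x i + (-c) * ?y i)" by (rule dotp_nonneg)
  also have "\<dots> = dotp n x x - 2 * c * dotp n x ?y + c\<^sup>2 * dotp n ?y ?y"
    unfolding dotp_add_left dotp_add_right dotp_scale_left dotp_scale_right
    by (simp add: dotp_comm[of n ?y x] algebra_simps power2_eq_square)
  finally have 1: "2 * (c * dotp n x ?y) \<le> dotp n x x + c\<^sup>2 * dotp n ?y ?y" by simp
  have "c * dotp n ?y ?y \<le> dotp n x ?y"
    using lower[of ?y] by (simp only: quad_mulv_inverse) (simp only: quad_def)
  then have "c * (c * dotp n ?y ?y) \<le> c * dotp n x ?y"
    using c_pos by (intro mult_left_mono) auto
  with 1 show ?thesis by (simp add: power2_eq_square)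
qed

lemma inverse_col_norm:
  assumes "j < n"
  shows "c\<^sup>2 * (\<Sum>i<n. (G i j)\<^sup>2) \<le> 1"
proof -
  have "(\<Sum>i<n. (G i j)\<^sup>2) = dotp n (mulv n G (unit j)) (mulv n G (unit j))"
    using assms by (simp add: dotp_def mulv_unit power2_eq_square)
  moreover have "dotp n (unit j) (unit j) = 1" using assms by (simp add: dotp_unit) (simp add: unit_def)
  ultimately show ?thesis using mulv_inverse_norm[of "unit j"] by simp
qed

lemma inverse_diag_le:
  assumes "j < n"
  shows "c * G j j \<le> 1"
proof -
  have "(c * G j j)\<^sup>2 \<le> c\<^sup>2 * (\<Sum>i<n. (G i j)\<^sup>2)"
    unfolding power_mult_distrib using assms by (intro mult_left_mono member_le_sum) auto
  also have "\<dots> \<le> 1" by (rule inverse_col_norm[OF assms])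
  finally show ?thesis by (metis abs_le_D1 abs_square_le_1)
qed

text \<open>The form of \<open>A\<close> is nonnegative at \<open>x\<close> minus the
  \<open>k\<close>-th column of \<open>G\<close>; expanding it gives the claim, with equality when
  \<open>x\<close> is that column. Test vectors thus bound diagonal entries of an inverse from below
  without any Schur complement formula.\<close>

lemma inverse_diag_variational:
  assumes "k < n"
  shows "2 * x k - quad n A x \<le> G k k"
proof -
  let ?g = "\<lambda>i. G i k"
  have "0 \<le> quad n A (\<lambda>i. x i + (-1) * ?g i)" by (rule quad_nonneg)
  also have "\<dots> = quad n A x - 2 * dotp n ?g (mulv n A x) + quad n A ?g"
    by (subst quad_add[OF symm]) simp
  also have "dotp n ?g (mulv n A x) = dotp n x (mulv n A ?g)" by (rule dotp_mulv_symm[OF symm])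
  also have "dotp n x (mulv n A ?g) = dotp n x (unit k)"
    using assms by (intro dotp_cong) (auto simp: mulv_inverse_col)
  also have "quad n A ?g = dotp n ?g (unit k)"
    unfolding quad_def using assms by (intro dotp_cong) (auto simp: mulv_inverse_col)
  finally show ?thesis using assms by (simp add: dotp_comm[of n _ "unit k"] dotp_unit)
qed

text \<open>\<open>G k k\<close> is the value of the form of \<open>A\<close> at the
  \<open>k\<close>-th column of \<open>G\<close>, which is not zero because \<open>A\<close> maps it
  to a unit vector.\<close>

lemma inverse_diag_pos:
  assumes "k < n"
  shows "0 < G k k"
proof -
  have "quad n A (\<lambda>i. G i k) = dotp n (\<lambda>i. G i k) (unit k)"
    unfolding quad_def using assms by (intro dotp_cong) (auto simp: mulv_inverse_col)
  then have q: "quad n A (\<lambda>i. G i k) = G k k" using assms by (simp add: dotp_comm[of n _ "unit k"] dotp_unit)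
  have "dotp n (\<lambda>i. G i k) (\<lambda>i. G i k) \<noteq> 0"
  proof
    assume "dotp n (\<lambda>i. G i k) (\<lambda>i. G i k) = 0"
    then have "\<forall>i<n. G i k = 0" by (simp add: dotp_eq_0_iff)
    then have "(\<Sum>i<n. A k i * G i k) = 0" by simp
    with mult_inverse[OF assms assms] show False by simp
  qed
  then have "0 < c * dotp n (\<lambda>i. G i k) (\<lambda>i. G i k)"
    using c_pos dotp_nonneg[of n "\<lambda>i. G i k"] by (simp add: less_eq_real_def)
  with lower[of "\<lambda>i. G i k"] q show ?thesis by simp
qed

end

section \<open>Measurability\<close>

lemma borel_measurable_det:
  assumes "\<And>i j. i < n \<Longrightarrow> j < n \<Longrightarrow> (\<lambda>w. B w $$ (i, j)) \<in> borel_measurable M"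
    and "\<And>w. B w \<in> carrier_mat n n"
  shows "(\<lambda>w. Determinant.det (B w) :: real) \<in> borel_measurable M"
proof -
  have "(\<lambda>w. Determinant.det (B w)) = (\<lambda>w. \<Sum>p | p permutes {0..<n}. signof p * (\<Prod>i = 0..<n. B w $$ (i, p i)))"
    using det_def'[OF assms(2)] by simp
  moreover have "(\<lambda>w. \<Sum>p | p permutes {0..<n}. signof p * (\<Prod>i = 0..<n. B w $$ (i, p i))) \<in> borel_measurable M"
  proof (intro borel_measurable_sum borel_measurable_times borel_measurable_const borel_measurable_prod)
    fix p i assume "p \<in> {p. p permutes {0..<n}}" "i \<in> {0..<n}"
    then show "(\<lambda>w. B w $$ (i, p i)) \<in> borel_measurable M"
      by (intro assms(1)) (auto dest: permutes_in_image)
  qed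
  ultimately show ?thesis by simp
qed

lemma borel_measurable_inv_entry:
  assumes A: "\<And>i j. i < n \<Longrightarrow> j < n \<Longrightarrow> (\<lambda>w. A w i j) \<in> borel_measurable M"
    and ij: "i < n" "j < n"
  shows "(\<lambda>w. inv_entry n (A w) i j) \<in> borel_measurable M"
proof -
  have d: "(\<lambda>w. Determinant.det (mat_of n (A w))) \<in> borel_measurable M"
    using A by (intro borel_measurable_det[where n = n]) (auto simp: mat_of_def)
  \<comment> \<open>The adjugate is the transposed cofactor matrix: its entry at
    \<open>(i, j)\<close> comes from deleting row \<open>j\<close> and column
    \<open>i\<close>.\<close>
  have "(\<lambda>w. Determinant.det (mat_delete (mat_of n (A w)) j i)) \<in> borel_measurable M"
  proof (rule borel_measurable_det[where n = "n - 1"])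
    fix k l assume kl: "k < n - 1" "l < n - 1"
    have "(\<lambda>w. mat_delete (mat_of n (A w)) j i $$ (k, l)) =
      (\<lambda>w. A w (if k < j then k else Suc k) (if l < i then l else Suc l))"
      using kl by (auto simp: mat_delete_def mat_of_def)
    also have "\<dots> \<in> borel_measurable M" using kl by (intro A) auto
    finally show "(\<lambda>w. mat_delete (mat_of n (A w)) j i $$ (k, l)) \<in> borel_measurable M" .
  qed (auto simp: mat_of_def)
  then have "(\<lambda>w. adj_mat (mat_of n (A w)) $$ (i, j)) \<in> borel_measurable M"
    using ij by (simp add: adj_mat_def cofactor_def mat_of_def)
  then show ?thesis unfolding inv_entry_def using d by (intro borel_measurable_divide)
qed

text \<open>Lists of rationals form a countable type whose members of length \<open>n\<close> are
  dense among the test vectors; both sides are continuous in the vector.\<close>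

lemma quad_le_if_quad_le_rat:
  assumes "\<And>xs :: rat list. quad n A (\<lambda>i. of_rat (xs ! i)) \<le> c * dotp n (\<lambda>i. of_rat (xs ! i)) (\<lambda>i. of_rat (xs ! i))"
  shows "quad n A x \<le> c * dotp n x x"
proof -
  have "\<exists>q. (\<lambda>m. real_of_rat (q m)) \<longlonglongrightarrow> x i" for i
  proof -
    have "\<exists>r. x i < of_rat r \<and> of_rat r < x i + 1 / real (Suc m)" for m
      by (rule of_rat_dense) simp
    then obtain q where q: "\<And>m. x i < real_of_rat (q m)" "\<And>m. real_of_rat (q m) < x i + 1 / real (Suc m)"
      by metis
    have "(\<lambda>m. real_of_rat (q m)) \<longlonglongrightarrow> x i"
    proof (rule tendsto_sandwich[of "\<lambda>m. x i" _ _ "\<lambda>m. x i + 1 / real (Suc m)"])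
      show "(\<lambda>m. x i + 1 / real (Suc m)) \<longlonglongrightarrow> x i"
        using tendsto_add[OF tendsto_const[of "x i" sequentially] LIMSEQ_inverse_real_of_nat] by (simp add: inverse_eq_divide)
    qed (use q in \<open>auto intro!: always_eventually less_imp_le\<close>)
    then show ?thesis by blast
  qed
  then obtain q where q: "\<And>i. (\<lambda>m. real_of_rat (q i m)) \<longlonglongrightarrow> x i" by metis
  have le: "quad n A (\<lambda>i. of_rat (q i m)) \<le> c * dotp n (\<lambda>i. of_rat (q i m)) (\<lambda>i. of_rat (q i m))" for m
  proof -
    let ?xs = "map (\<lambda>i. q i m) [0..<n]"
    have "quad n A (\<lambda>i. of_rat (?xs ! i)) = quad n A (\<lambda>i. of_rat (q i m))"
      by (rule quad_cong) simp
    moreover have "dotp n (\<lambda>i. of_rat (?xs ! i)) (\<lambda>i. of_rat (?xs ! i)) = dotp n (\<lambda>i. of_rat (q i m)) (\<lambda>i. of_rat (q i m))"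
      by (rule dotp_cong) simp_all
    ultimately show ?thesis using assms[of ?xs] by simp
  qed
  show ?thesis
  proof (rule LIMSEQ_le)
    show "(\<lambda>m. quad n A (\<lambda>i. of_rat (q i m))) \<longlonglongrightarrow> quad n A x"
      unfolding quad_def dotp_def mulv_def by (intro tendsto_intros q)
    show "(\<lambda>m. c * dotp n (\<lambda>i. of_rat (q i m)) (\<lambda>i. of_rat (q i m))) \<longlonglongrightarrow> c * dotp n x x"
      unfolding dotp_def by (intro tendsto_intros q)
  qed (use le in blast)
qed

text \<open>By the variational characterisation a sublevel set of \<open>lambda1\<close> is an
  intersection of conditions indexed by rational lists, which are countably many.\<close>

lemma borel_measurable_lambda1:
  assumes "n > 0" and s: "\<And>w. symm n (A w)"
    and A[measurable]: "\<And>i j. i < n \<Longrightarrow> j < n \<Longrightarrow> (\<lambda>w. A w i j) \<in> borel_measurable M"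
  shows "(\<lambda>w. lambda1 (mat_of n (A w))) \<in> borel_measurable M"
proof (rule borel_measurableI_le)
  fix c
  have [measurable]: "(\<lambda>w. quad n (A w) x) \<in> borel_measurable M" for x
    unfolding quad_def dotp_def mulv_def
    by (intro borel_measurable_sum borel_measurable_times borel_measurable_const A) auto
  have "lambda1 (mat_of n (A w)) \<le> c \<longleftrightarrow>
      (\<forall>xs :: rat list. quad n (A w) (\<lambda>i. of_rat (xs ! i)) \<le> c * dotp n (\<lambda>i. of_rat (xs ! i)) (\<lambda>i. of_rat (xs ! i)))" for w
    unfolding lambda1_le_iff[OF s assms(1)] by (blast intro: quad_le_if_quad_le_rat)
  then show "{w \<in> space M. lambda1 (mat_of n (A w)) \<le> c} \<in> sets M"
    by simp
qed

section \<open>Second moments of quadratic forms\<close>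

text \<open>On a finite measure the function \<open>1 + \<bar>x\<bar> ^ N\<close> is an integrable
  majorant.\<close>

lemma integrable_lower_power:
  fixes M :: "real measure"
  assumes "finite_measure M" "sets M = sets borel" "integrable M (\<lambda>x. \<bar>x\<bar> ^ N)" "k \<le> N"
  shows "integrable M (\<lambda>x. x ^ k)"
proof (rule Bochner_Integration.integrable_bound)
  interpret finite_measure M by fact
  show "integrable M (\<lambda>x. 1 + \<bar>x\<bar> ^ N)" using assms(3) by simp
  have "\<bar>x\<bar> ^ k \<le> 1 + \<bar>x\<bar> ^ N" for x :: real
  proof (cases "\<bar>x\<bar> \<le> 1")
    case True
    then show ?thesis using power_le_one[of "\<bar>x\<bar>" k] zero_le_power[of "\<bar>x\<bar>" N] by linarith
  next
    case False
    then show ?thesis using power_increasing[OF assms(4), of "\<bar>x\<bar>"] by linarith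
  qed
  then show "AE x in M. norm (x ^ k) \<le> norm (1 + \<bar>x\<bar> ^ N)"
    by (simp add: power_abs)
  show "(\<lambda>x. x ^ k) \<in> borel_measurable M"
    by (simp add: measurable_cong_sets[OF assms(2) refl])
qed

locale entry_law = prob_space \<mu> for \<mu> :: "real measure" +
  assumes sets_law [measurable_cong]: "sets \<mu> = sets borel"
    and integrable_pow4: "integrable \<mu> (\<lambda>x. x ^ 4)"
begin

definition mean :: real where "mean = (\<integral>x. x \<partial>\<mu>)"
definition var :: real where "var = (\<integral>x. (x - mean)\<^sup>2 \<partial>\<mu>)"
text \<open>Twice the variance of the squared centred entry; the factor 2 comes from splitting a
  square in \<open>single_coordinate_bound\<close>.\<close>

definition kap :: real where "kap = (\<integral>x. 2 * ((x - mean)\<^sup>2 - var)\<^sup>2 \<partial>\<mu>)"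
text \<open>The three summands pay for the diagonal, linear and off-diagonal contributions in the
  induction of \<open>centred_form_second_moment\<close>.\<close>

definition qconst :: real where "qconst = kap + 2 * var + 8 * var\<^sup>2"

lemma integrable_pow: "k \<le> 4 \<Longrightarrow> integrable \<mu> (\<lambda>x. x ^ k)"
  using integrable_lower_power[OF finite_measure_axioms sets_law, of 4 k] integrable_pow4 by simp

lemma integrable_shift_pow:
  assumes "k \<le> 4"
  shows "integrable \<mu> (\<lambda>x. (x + a) ^ k)"
  unfolding binomial_ring using assms
  by (intro Bochner_Integration.integrable_sum integrable_mult_left integrable_mult_right integrable_pow) auto

lemma integrable_centred [simp]: "integrable \<mu> (\<lambda>x. x - mean)"
  using integrable_shift_pow[of 1 "- mean"] by simp

lemma integrable_centred2 [simp]: "integrable \<mu> (\<lambda>x. (x - mean)\<^sup>2)"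
  using integrable_shift_pow[of 2 "- mean"] by simp

lemma integrable_centred4 [simp]: "integrable \<mu> (\<lambda>x. ((x - mean)\<^sup>2 - var)\<^sup>2)"
proof -
  have "((x - mean)\<^sup>2 - var)\<^sup>2 = (x + (- mean)) ^ 4 - 2 * var * (x - mean)\<^sup>2 + var\<^sup>2" for x
  proof -
    have "(y\<^sup>2 - v)\<^sup>2 = y ^ 4 - 2 * v * y\<^sup>2 + v\<^sup>2" for y v :: real
      by (simp add: power2_eq_square power4_eq_xxxx algebra_simps)
    from this[of "x - mean" var] show ?thesis by simp
  qed
  then show ?thesis using integrable_shift_pow[of 4 "- mean"] by simp
qed

lemma integral_centred [simp]: "(\<integral>x. x - mean \<partial>\<mu>) = 0"
proof -
  have "integrable \<mu> (\<lambda>x. x)" using integrable_pow[of 1] by simp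
  then show ?thesis by (simp add: mean_def prob_space)
qed

lemma var_nonneg: "0 \<le> var" by (simp add: var_def)
lemma kap_nonneg: "0 \<le> kap" by (simp add: kap_def)
lemma qconst_nonneg: "0 \<le> qconst" using var_nonneg kap_nonneg by (simp add: qconst_def)

text \<open>The terms with \<open>g\<close> and \<open>L\<close> have mean zero, so their products
  with the constant \<open>F\<close> integrate to zero. Their product with each other involves a
  third moment and is absorbed by \<open>(a + b)^2 <= 2 a^2 + 2 b^2\<close>.\<close>

lemma single_coordinate_bound:
  "(\<integral>\<^sup>+x. ennreal ((F + g * ((x - mean)\<^sup>2 - var) + (x - mean) * L)\<^sup>2) \<partial>\<mu>)
    \<le> ennreal (F\<^sup>2 + kap * g\<^sup>2 + 2 * var * L\<^sup>2)"
proof -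
  define R where "R = (\<lambda>x. F\<^sup>2 + 2 * F * (g * ((x - mean)\<^sup>2 - var) + (x - mean) * L)
    + (g\<^sup>2 * (2 * ((x - mean)\<^sup>2 - var)\<^sup>2) + 2 * L\<^sup>2 * (x - mean)\<^sup>2))"
  have le: "(F + g * ((x - mean)\<^sup>2 - var) + (x - mean) * L)\<^sup>2 \<le> R x" for x
  proof -
    have "(F + a + b)\<^sup>2 \<le> F\<^sup>2 + 2 * F * (a + b) + (2 * a\<^sup>2 + 2 * b\<^sup>2)" for a b :: real
      using zero_le_power2[of "a - b"] by (simp add: power2_eq_square algebra_simps)
    from this[of "g * ((x - mean)\<^sup>2 - var)" "(x - mean) * L"] show ?thesis
      unfolding R_def by (simp add: power_mult_distrib mult.commute mult.left_commute)
  qed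
  have "integrable \<mu> R" unfolding R_def
    by (intro Bochner_Integration.integrable_add Bochner_Integration.integrable_diff
        integrable_mult_right integrable_mult_left integrable_centred integrable_centred2
        integrable_centred4 integrable_const)
  have "(\<integral>x. R x \<partial>\<mu>) = F\<^sup>2 + kap * g\<^sup>2 + 2 * var * L\<^sup>2"
    unfolding R_def by (simp add: prob_space kap_def var_def[symmetric])
  moreover have "(\<integral>\<^sup>+x. ennreal (R x) \<partial>\<mu>) = ennreal (\<integral>x. R x \<partial>\<mu>)"
    using \<open>integrable \<mu> R\<close> by (rule nn_integral_eq_integral) (auto intro!: order_trans[OF zero_le_power2 le])
  moreover have "(\<integral>\<^sup>+x. ennreal ((F + g * ((x - mean)\<^sup>2 - var) + (x - mean) * L)\<^sup>2) \<partial>\<mu>) \<le> (\<integral>\<^sup>+x. ennreal (R x) \<partial>\<mu>)"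
    by (intro nn_integral_mono ennreal_leI le)
  ultimately show ?thesis by simp
qed

lemma measurable_coord: "i \<in> I \<Longrightarrow> (\<lambda>w. w i) \<in> borel_measurable (PiM I (\<lambda>_. \<mu>))"
  using measurable_component_singleton[of i I "\<lambda>_. \<mu>"] by (simp add: measurable_cong_sets[OF refl sets_law])

lemma prob_space_PiM_law: "prob_space (PiM I (\<lambda>_. \<mu>))"
  by (rule prob_space_PiM) (rule prob_space_axioms)

lemma product_sigma_finite_law: "product_sigma_finite (\<lambda>_. \<mu>)"
  by standard

text \<open>Fubini's theorem integrates out one coordinate at a time, using
  \<open>single_coordinate_bound\<close> without quadratic term; the factor 2 is inherited from
  there. The injection \<open>e\<close> places the summation indices among the coordinates.\<close>

lemma linear_second_moment:
  fixes e :: "'k \<Rightarrow> 'i"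
  assumes "finite S" "inj_on e S"
  shows "(\<integral>\<^sup>+w. ennreal ((a + (\<Sum>k\<in>S. c k * (w (e k) - mean)))\<^sup>2) \<partial>PiM (e ` S) (\<lambda>_. \<mu>))
    \<le> ennreal (a\<^sup>2 + 2 * var * (\<Sum>k\<in>S. (c k)\<^sup>2))"
  using assms
proof (induction S rule: finite_induct)
  case empty
  interpret P: prob_space "PiM {} (\<lambda>_::'i. \<mu>)" by (rule prob_space_PiM_law)
  show ?case by (simp add: P.emeasure_space_1)
next
  case (insert k S)
  interpret P: prob_space "PiM (e ` S) (\<lambda>_. \<mu>)" by (rule prob_space_PiM_law)
  interpret X: product_sigma_finite "\<lambda>_::'i. \<mu>" by (rule product_sigma_finite_law)
  have ek: "e k \<notin> e ` S" using insert by auto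
  let ?F = "\<lambda>w. a + (\<Sum>k\<in>S. c k * (w (e k) - mean))"
  have F[measurable]: "?F \<in> borel_measurable (PiM (e ` S) (\<lambda>_. \<mu>))"
    by (intro borel_measurable_add borel_measurable_sum borel_measurable_times borel_measurable_diff
        borel_measurable_const measurable_coord) auto
  have m: "(\<lambda>w. ennreal ((a + (\<Sum>k\<in>insert k S. c k * (w (e k) - mean)))\<^sup>2))
     \<in> borel_measurable (PiM (insert (e k) (e ` S)) (\<lambda>_. \<mu>))"
    by (intro measurable_compose[OF _ measurable_ennreal] borel_measurable_power borel_measurable_add borel_measurable_sum borel_measurable_times borel_measurable_diff
        borel_measurable_const measurable_coord) auto
  have "(\<integral>\<^sup>+w. ennreal ((a + (\<Sum>k\<in>insert k S. c k * (w (e k) - mean)))\<^sup>2) \<partial>PiM (e ` insert k S) (\<lambda>_. \<mu>))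
    = (\<integral>\<^sup>+w. (\<integral>\<^sup>+x. ennreal ((a + (\<Sum>j\<in>insert k S. c j * ((w(e k := x)) (e j) - mean)))\<^sup>2) \<partial>\<mu>) \<partial>PiM (e ` S) (\<lambda>_. \<mu>))"
    using insert.hyps ek m by (simp only: image_insert) (subst X.product_nn_integral_insert, auto)
  also have "\<dots> = (\<integral>\<^sup>+w. (\<integral>\<^sup>+x. ennreal ((?F w + 0 * ((x - mean)\<^sup>2 - var) + (x - mean) * c k)\<^sup>2) \<partial>\<mu>) \<partial>PiM (e ` S) (\<lambda>_. \<mu>))"
  proof (intro nn_integral_cong arg_cong[where f = ennreal] arg_cong[where f = "\<lambda>x. x\<^sup>2"])
    fix w x
    have "e j \<noteq> e k" if "j \<in> S" for j using that ek by (metis imageI)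
    then have "(\<Sum>j\<in>S. c j * ((w(e k := x)) (e j) - mean)) = (\<Sum>j\<in>S. c j * (w (e j) - mean))"
      by (intro sum.cong) auto
    then show "a + (\<Sum>j\<in>insert k S. c j * ((w(e k := x)) (e j) - mean)) =
        ?F w + 0 * ((x - mean)\<^sup>2 - var) + (x - mean) * c k"
      using insert.hyps by (simp add: mult.commute)
  qed
  also have "\<dots> \<le> (\<integral>\<^sup>+w. ennreal ((?F w)\<^sup>2) + ennreal (2 * var * (c k)\<^sup>2) \<partial>PiM (e ` S) (\<lambda>_. \<mu>))"
    using var_nonneg
    by (intro nn_integral_mono order_trans[OF single_coordinate_bound]) (simp flip: ennreal_plus)
  also have "\<dots> = (\<integral>\<^sup>+w. ennreal ((?F w)\<^sup>2) \<partial>PiM (e ` S) (\<lambda>_. \<mu>)) + ennreal (2 * var * (c k)\<^sup>2)"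
    by (subst nn_integral_add) (auto simp: P.emeasure_space_1)
  also have "\<dots> \<le> ennreal (a\<^sup>2 + 2 * var * (\<Sum>k\<in>S. (c k)\<^sup>2)) + ennreal (2 * var * (c k)\<^sup>2)"
    using insert by (intro add_right_mono) auto
  also have "\<dots> = ennreal (a\<^sup>2 + 2 * var * (\<Sum>k\<in>insert k S. (c k)\<^sup>2))"
    using insert.hyps var_nonneg by (subst ennreal_plus[symmetric]) (auto intro!: sum_nonneg add_nonneg_nonneg mult_nonneg_nonneg simp: algebra_simps)
  finally show ?case .
qed

text \<open>For independent coordinates of law \<open>\<mu>\<close> the quadratic part has
  expectation \<open>var\<close> times the trace of \<open>G\<close>, so the whole form has mean
  zero.\<close>

definition centred_form :: "'k set \<Rightarrow> ('k \<Rightarrow> 'k \<Rightarrow> real) \<Rightarrow> ('k \<Rightarrow> real) \<Rightarrow> ('k \<Rightarrow> real) \<Rightarrow> real" where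
  "centred_form S G b x = (\<Sum>k\<in>S. \<Sum>l\<in>S. G k l * (x k - mean) * (x l - mean))
     + (\<Sum>k\<in>S. b k * (x k - mean)) - var * (\<Sum>k\<in>S. G k k)"

text \<open>This isolates the new coordinate in the shape required by
  \<open>single_coordinate_bound\<close>; symmetry of \<open>G\<close> merges row \<open>k\<close>
  and column \<open>k\<close> into the factor 2.\<close>

lemma centred_form_insert:
  assumes "finite S" "k \<notin> S" "\<And>j l. j \<in> insert k S \<Longrightarrow> l \<in> insert k S \<Longrightarrow> G j l = G l j"
  shows "centred_form (insert k S) G b x = centred_form S G b x + G k k * ((x k - mean)\<^sup>2 - var)
    + (x k - mean) * (b k + (\<Sum>l\<in>S. 2 * G k l * (x l - mean)))"
proof -
  have "(\<Sum>j\<in>S. G j k * (x j - mean) * (x k - mean)) = (x k - mean) * (\<Sum>l\<in>S. G k l * (x l - mean))"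
    unfolding sum_distrib_left using assms(3) by (intro sum.cong) auto
  moreover have "(\<Sum>l\<in>S. G k l * (x k - mean) * (x l - mean)) = (x k - mean) * (\<Sum>l\<in>S. G k l * (x l - mean))"
    unfolding sum_distrib_left by (intro sum.cong) auto
  moreover have "(\<Sum>l\<in>S. 2 * G k l * (x l - mean)) = 2 * (\<Sum>l\<in>S. G k l * (x l - mean))"
    by (simp add: sum_distrib_left mult.assoc)
  ultimately show ?thesis
    using assms(1,2) unfolding centred_form_def
    by (simp add: sum.distrib power2_eq_square) (simp add: algebra_simps)
qed

lemma measurable_centred_form:
  assumes "e ` S \<subseteq> I"
    and "\<And>k l. k \<in> S \<Longrightarrow> l \<in> S \<Longrightarrow> (\<lambda>w. G w k l) \<in> borel_measurable (PiM I (\<lambda>_. \<mu>))"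
    and "\<And>k. k \<in> S \<Longrightarrow> (\<lambda>w. b w k) \<in> borel_measurable (PiM I (\<lambda>_. \<mu>))"
  shows "(\<lambda>w. centred_form S (G w) (b w) (\<lambda>k. w (e k))) \<in> borel_measurable (PiM I (\<lambda>_. \<mu>))"
  unfolding centred_form_def using assms
  by (intro borel_measurable_add borel_measurable_sum borel_measurable_times borel_measurable_diff
        borel_measurable_const measurable_coord) auto

text \<open>Induction on \<open>S\<close>, integrating out the newest coordinate first. Its linear
  coefficient is a random affine function of the earlier coordinates, whose second moment is bounded
  by \<open>linear_second_moment\<close>.\<close>

lemma centred_form_second_moment:
  fixes e :: "'k \<Rightarrow> 'i"
  assumes "finite S" "inj_on e S" "\<And>k l. k \<in> S \<Longrightarrow> l \<in> S \<Longrightarrow> G k l = G l k"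
  shows "(\<integral>\<^sup>+w. ennreal ((centred_form S G b (\<lambda>k. w (e k)))\<^sup>2) \<partial>PiM (e ` S) (\<lambda>_. \<mu>))
    \<le> ennreal (qconst * ((\<Sum>k\<in>S. \<Sum>l\<in>S. (G k l)\<^sup>2) + (\<Sum>k\<in>S. (b k)\<^sup>2)))"
  using assms
proof (induction S rule: finite_induct)
  case empty
  show ?case by (simp add: centred_form_def)
next
  case (insert k S)
  interpret P: prob_space "PiM (e ` S) (\<lambda>_. \<mu>)" by (rule prob_space_PiM_law)
  interpret X: product_sigma_finite "\<lambda>_::'i. \<mu>" by (rule product_sigma_finite_law)
  have ek: "e k \<notin> e ` S" using insert by auto
  let ?F = "\<lambda>w. centred_form S G b (\<lambda>k. w (e k))"
  let ?L = "\<lambda>w. b k + (\<Sum>l\<in>S. 2 * G k l * (w (e l) - mean))"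
  have F[measurable]: "?F \<in> borel_measurable (PiM (e ` S) (\<lambda>_. \<mu>))"
    by (rule measurable_centred_form) auto
  have L[measurable]: "?L \<in> borel_measurable (PiM (e ` S) (\<lambda>_. \<mu>))"
    by (intro borel_measurable_add borel_measurable_sum borel_measurable_times borel_measurable_diff
        borel_measurable_const measurable_coord) auto
  have m: "(\<lambda>w. ennreal ((centred_form (insert k S) G b (\<lambda>k. w (e k)))\<^sup>2))
     \<in> borel_measurable (PiM (insert (e k) (e ` S)) (\<lambda>_. \<mu>))"
    by (intro measurable_compose[OF _ measurable_ennreal] borel_measurable_power measurable_centred_form) auto
  have "(\<integral>\<^sup>+w. ennreal ((centred_form (insert k S) G b (\<lambda>k. w (e k)))\<^sup>2) \<partial>PiM (e ` insert k S) (\<lambda>_. \<mu>))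
    = (\<integral>\<^sup>+w. (\<integral>\<^sup>+x. ennreal ((centred_form (insert k S) G b (\<lambda>j. (w(e k := x)) (e j)))\<^sup>2) \<partial>\<mu>) \<partial>PiM (e ` S) (\<lambda>_. \<mu>))"
    using insert.hyps ek m by (simp only: image_insert) (subst X.product_nn_integral_insert, auto)
  also have "\<dots> = (\<integral>\<^sup>+w. (\<integral>\<^sup>+x. ennreal ((?F w + G k k * ((x - mean)\<^sup>2 - var) + (x - mean) * ?L w)\<^sup>2) \<partial>\<mu>) \<partial>PiM (e ` S) (\<lambda>_. \<mu>))"
  proof (intro nn_integral_cong arg_cong[where f = ennreal] arg_cong[where f = "\<lambda>x. x\<^sup>2"])
    fix w :: "'i \<Rightarrow> real" and x
    have 1: "(w(e k := x)) (e j) = w (e j)" if "j \<in> S" for j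
    proof -
      have "e j \<noteq> e k" using that ek by (metis imageI)
      then show ?thesis by simp
    qed
    have "centred_form S G b (\<lambda>j. (w(e k := x)) (e j)) = ?F w"
      unfolding centred_form_def using 1 by simp
    moreover have "(\<Sum>l\<in>S. 2 * G k l * ((w(e k := x)) (e l) - mean)) = (\<Sum>l\<in>S. 2 * G k l * (w (e l) - mean))"
      using 1 by (intro sum.cong) auto
    ultimately show "centred_form (insert k S) G b (\<lambda>j. (w(e k := x)) (e j)) =
        ?F w + G k k * ((x - mean)\<^sup>2 - var) + (x - mean) * ?L w"
      using insert.hyps insert.prems(2) by (subst centred_form_insert) auto
  qed
  also have "\<dots> \<le> (\<integral>\<^sup>+w. ennreal ((?F w)\<^sup>2) + (ennreal (kap * (G k k)\<^sup>2) + ennreal (2 * var) * ennreal ((?L w)\<^sup>2)) \<partial>PiM (e ` S) (\<lambda>_. \<mu>))"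
    using var_nonneg kap_nonneg
    by (intro nn_integral_mono order_trans[OF single_coordinate_bound]) (simp flip: ennreal_plus ennreal_mult)
  also have "\<dots> = (\<integral>\<^sup>+w. ennreal ((?F w)\<^sup>2) \<partial>PiM (e ` S) (\<lambda>_. \<mu>))
      + (ennreal (kap * (G k k)\<^sup>2) + ennreal (2 * var) * (\<integral>\<^sup>+w. ennreal ((?L w)\<^sup>2) \<partial>PiM (e ` S) (\<lambda>_. \<mu>)))"
    by (simp add: nn_integral_add nn_integral_cmult P.emeasure_space_1)
  also have "\<dots> \<le> ennreal (qconst * ((\<Sum>k\<in>S. \<Sum>l\<in>S. (G k l)\<^sup>2) + (\<Sum>k\<in>S. (b k)\<^sup>2)))
      + (ennreal (kap * (G k k)\<^sup>2) + ennreal (2 * var) * ennreal ((b k)\<^sup>2 + 2 * var * (\<Sum>l\<in>S. (2 * G k l)\<^sup>2)))"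
    using insert by (intro add_mono mult_left_mono order_refl linear_second_moment) auto
  also have "\<dots> = ennreal (qconst * ((\<Sum>k\<in>S. \<Sum>l\<in>S. (G k l)\<^sup>2) + (\<Sum>k\<in>S. (b k)\<^sup>2))
      + (kap * (G k k)\<^sup>2 + 2 * var * ((b k)\<^sup>2 + 2 * var * (\<Sum>l\<in>S. (2 * G k l)\<^sup>2))))"
    using var_nonneg kap_nonneg qconst_nonneg
    by (simp add: ennreal_plus ennreal_mult sum_nonneg)
  also have "\<dots> \<le> ennreal (qconst * ((\<Sum>j\<in>insert k S. \<Sum>l\<in>insert k S. (G j l)\<^sup>2) + (\<Sum>k\<in>insert k S. (b k)\<^sup>2)))"
  proof (rule ennreal_leI)
    define a where "a = (\<Sum>k\<in>S. \<Sum>l\<in>S. (G k l)\<^sup>2)"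
    define r where "r = (\<Sum>l\<in>S. (G k l)\<^sup>2)"
    define d where "d = (\<Sum>k\<in>S. (b k)\<^sup>2)"
    have r': "(\<Sum>j\<in>S. (G j k)\<^sup>2) = r"
      unfolding r_def using insert.prems(2) by (intro sum.cong) auto
    have r2: "(\<Sum>l\<in>S. (2 * G k l)\<^sup>2) = 4 * r"
      by (simp add: r_def power_mult_distrib sum_distrib_left)
    \<comment> \<open>The new index adds a row, an equal column and a diagonal entry. The
      off-diagonal cost \<open>16 * var\<^sup>2 * r\<close> is therefore charged to
      \<open>2 * r\<close>, which explains the 8 in \<open>qconst\<close>.\<close>
    have eq1: "(\<Sum>j\<in>insert k S. \<Sum>l\<in>insert k S. (G j l)\<^sup>2) = a + 2 * r + (G k k)\<^sup>2"
      using insert.hyps r' by (simp add: sum.distrib a_def r_def)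
    have eq2: "(\<Sum>k\<in>insert k S. (b k)\<^sup>2) = (b k)\<^sup>2 + d"
      using insert.hyps by (simp add: d_def)
    have r0: "0 \<le> r" by (simp add: r_def sum_nonneg)
    have "kap * (G k k)\<^sup>2 \<le> qconst * (G k k)\<^sup>2"
      using var_nonneg by (intro mult_right_mono) (auto simp: qconst_def)
    moreover have "2 * var * (b k)\<^sup>2 \<le> qconst * (b k)\<^sup>2"
      using kap_nonneg by (intro mult_right_mono) (auto simp: qconst_def)
    moreover have "8 * var\<^sup>2 * (2 * r) \<le> qconst * (2 * r)"
      using kap_nonneg var_nonneg r0 by (intro mult_right_mono) (auto simp: qconst_def)
    ultimately have "qconst * (a + d) + (kap * (G k k)\<^sup>2 + 2 * var * ((b k)\<^sup>2 + 2 * var * (4 * r)))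
      \<le> qconst * ((a + 2 * r + (G k k)\<^sup>2) + ((b k)\<^sup>2 + d))"
      by (simp add: algebra_simps power2_eq_square)
    then show "qconst * ((\<Sum>k\<in>S. \<Sum>l\<in>S. (G k l)\<^sup>2) + (\<Sum>k\<in>S. (b k)\<^sup>2))
      + (kap * (G k k)\<^sup>2 + 2 * var * ((b k)\<^sup>2 + 2 * var * (\<Sum>l\<in>S. (2 * G k l)\<^sup>2)))
      \<le> qconst * ((\<Sum>j\<in>insert k S. \<Sum>l\<in>insert k S. (G j l)\<^sup>2) + (\<Sum>k\<in>insert k S. (b k)\<^sup>2))"
      using eq1 eq2 by (simp only: r2 a_def[symmetric] d_def[symmetric])
  qed
  finally show ?case .
qed

lemma centred_form_second_moment_random:
  fixes e :: "'k \<Rightarrow> 'i"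
  assumes "finite U" "finite S" "inj_on e S" "e ` S \<subseteq> U" "0 \<le> \<beta>"
    and mG: "\<And>k l. k \<in> S \<Longrightarrow> l \<in> S \<Longrightarrow> (\<lambda>w. G w k l) \<in> borel_measurable (PiM U (\<lambda>_. \<mu>))"
    and mb: "\<And>k. k \<in> S \<Longrightarrow> (\<lambda>w. b w k) \<in> borel_measurable (PiM U (\<lambda>_. \<mu>))"
    and mP: "Measurable.pred (PiM U (\<lambda>_. \<mu>)) P"
    and indep: "\<And>w w'. (\<And>u. u \<in> U - e ` S \<Longrightarrow> w u = w' u) \<Longrightarrow> P w = P w' \<and> G w = G w' \<and> b w = b w'"
    and sym: "\<And>w k l. P w \<Longrightarrow> k \<in> S \<Longrightarrow> l \<in> S \<Longrightarrow> G w k l = G w l k"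
    and bnd: "\<And>w. P w \<Longrightarrow> (\<Sum>k\<in>S. \<Sum>l\<in>S. (G w k l)\<^sup>2) + (\<Sum>k\<in>S. (b w k)\<^sup>2) \<le> \<beta>"
  shows "(\<integral>\<^sup>+w. ennreal (if P w then (centred_form S (G w) (b w) (\<lambda>k. w (e k)))\<^sup>2 else 0) \<partial>PiM U (\<lambda>_. \<mu>))
    \<le> ennreal (qconst * \<beta>)"
proof -
  let ?I = "U - e ` S" and ?J = "e ` S"
  let ?f = "\<lambda>w. ennreal (if P w then (centred_form S (G w) (b w) (\<lambda>k. w (e k)))\<^sup>2 else 0)"
  interpret X: product_sigma_finite "\<lambda>_::'i. \<mu>" by (rule product_sigma_finite_law)
  interpret P: prob_space "PiM ?I (\<lambda>_. \<mu>)" by (rule prob_space_PiM_law)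
  have U: "?I \<union> ?J = U" using assms(4) by auto
  have "?f \<in> borel_measurable (PiM U (\<lambda>_. \<mu>))"
    using mP assms(4) mG mb
    by (intro measurable_compose[OF _ measurable_ennreal] measurable_If borel_measurable_power measurable_centred_form) auto
  then have "(\<integral>\<^sup>+w. ?f w \<partial>PiM U (\<lambda>_. \<mu>)) = (\<integral>\<^sup>+x. (\<integral>\<^sup>+y. ?f (merge ?I ?J (x, y)) \<partial>PiM ?J (\<lambda>_. \<mu>)) \<partial>PiM ?I (\<lambda>_. \<mu>))"
    using X.product_nn_integral_fold[of ?I ?J ?f] assms(1,2) unfolding U by auto
  also have "\<dots> \<le> (\<integral>\<^sup>+x. ennreal (qconst * \<beta>) \<partial>PiM ?I (\<lambda>_. \<mu>))"
  proof (rule nn_integral_mono)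
    fix x
    define H where "H = G (merge ?I ?J (x, undefined))"
    define d where "d = b (merge ?I ?J (x, undefined))"
    define p where "p = P (merge ?I ?J (x, undefined))"
    have ind: "P (merge ?I ?J (x, y)) = p \<and> G (merge ?I ?J (x, y)) = H \<and> b (merge ?I ?J (x, y)) = d" for y
      unfolding H_def d_def p_def by (rule indep) (auto simp: merge_def)
    have mj: "merge ?I ?J (x, y) (e k) = y (e k)" if "k \<in> S" for y k
      using that by (simp add: merge_def)
    have "?f (merge ?I ?J (x, y)) = ennreal (if p then (centred_form S H d (\<lambda>k. y (e k)))\<^sup>2 else 0)" for y
    proof -
      have "centred_form S H d (\<lambda>k. merge ?I ?J (x, y) (e k)) = centred_form S H d (\<lambda>k. y (e k))"
        unfolding centred_form_def using mj by (simp cong: sum.cong)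
      moreover have "P (merge ?I ?J (x, y)) = p" "G (merge ?I ?J (x, y)) = H" "b (merge ?I ?J (x, y)) = d"
        using ind[of y] by blast+
      ultimately show ?thesis by (simp only:)
    qed
    then have "(\<integral>\<^sup>+y. ?f (merge ?I ?J (x, y)) \<partial>PiM ?J (\<lambda>_. \<mu>)) =
       (\<integral>\<^sup>+y. ennreal (if p then (centred_form S H d (\<lambda>k. y (e k)))\<^sup>2 else 0) \<partial>PiM ?J (\<lambda>_. \<mu>))"
      by (intro nn_integral_cong) (simp only:)
    also have "\<dots> \<le> ennreal (qconst * \<beta>)"
    proof (cases p)
      case True
      have "(\<integral>\<^sup>+y. ennreal ((centred_form S H d (\<lambda>k. y (e k)))\<^sup>2) \<partial>PiM ?J (\<lambda>_. \<mu>))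
        \<le> ennreal (qconst * ((\<Sum>k\<in>S. \<Sum>l\<in>S. (H k l)\<^sup>2) + (\<Sum>k\<in>S. (d k)\<^sup>2)))"
        using True unfolding H_def p_def by (intro centred_form_second_moment assms(2,3) sym)
      also have "\<dots> \<le> ennreal (qconst * \<beta>)"
        using True qconst_nonneg unfolding H_def p_def d_def
        by (intro ennreal_leI mult_left_mono bnd)
      finally show ?thesis using True by simp
    qed (simp add: qconst_nonneg assms(5))
    finally show "(\<integral>\<^sup>+y. ?f (merge ?I ?J (x, y)) \<partial>PiM ?J (\<lambda>_. \<mu>)) \<le> ennreal (qconst * \<beta>)" .
  qed
  also have "\<dots> = ennreal (qconst * \<beta>)" by (simp add: P.emeasure_space_1)
  finally show ?thesis .
qed

end

section \<open>The resolvent inequality\<close>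

text \<open>Clearing row and column \<open>i\<close>, instead of deleting them, keeps all matrices of size \<open>n\<close>.\<close>

definition clear_index :: "nat \<Rightarrow> (nat \<Rightarrow> nat \<Rightarrow> real) \<Rightarrow> nat \<Rightarrow> nat \<Rightarrow> real" where
  "clear_index i B k l = (if k = i \<or> l = i then 0 else B k l)"

lemma symm_clear_index: "symm n B \<Longrightarrow> symm n (clear_index i B)"
  by (auto simp: symm_def clear_index_def)

lemma quad_double_sum: "quad n A x = (\<Sum>k<n. \<Sum>l<n. A k l * x k * x l)"
  by (simp add: quad_def dotp_def mulv_def sum_distrib_left algebra_simps)

lemma quad_clear_index: "quad n (clear_index i B) x = quad n B (\<lambda>k. if k = i then 0 else x k)"
  unfolding quad_double_sum by (intro sum.cong) (auto simp: clear_index_def)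

lemma quad_shifted_clear_index:
  assumes "x i = 0"
  shows "quad n (shifted T (clear_index i B)) x = quad n (shifted T B) x"
proof -
  have "(\<lambda>k. if k = i then 0 else x k) = x" using assms by auto
  then show ?thesis by (simp add: quad_shifted quad_clear_index)
qed

lemma pos_def_shifted:
  assumes "symm n B" "c > 0" "\<And>x. quad n B x \<le> (T - c) * dotp n x x"
  shows "pos_def_matrix n (shifted T B) c"
proof
  show "c * dotp n x x \<le> quad n (shifted T B) x" for x
    using assms(3)[of x] by (simp add: quad_shifted algebra_simps)
qed (use assms symm_shifted in auto)

text \<open>Clearing an index amounts to zeroing a coordinate of the vector, which does not increase
  its norm; as \<open>K\<close> is nonnegative the bound survives.\<close>

lemma clear_index_upper_bound:
  assumes "\<And>x. quad n B x \<le> K * dotp n x x" "0 \<le> K"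
  shows "quad n (clear_index i B) x \<le> K * dotp n x x"
proof -
  have "dotp n (\<lambda>k. if k = i then 0 else x k) (\<lambda>k. if k = i then 0 else x k) \<le> dotp n x x"
    unfolding dotp_def by (intro sum_mono) auto
  then show ?thesis
    using assms(1)[of "\<lambda>k. if k = i then 0 else x k"] mult_left_mono[OF _ assms(2)]
    unfolding quad_clear_index by (meson order_trans)
qed

text \<open>The spectrum lies at distance at least \<open>c\<close> below \<open>T\<close>. The
  condition \<open>c \<le> T\<close> makes \<open>T - c\<close> nonnegative, so that the bound
  passes to matrices with a cleared index.\<close>

locale bounded_symm_matrix =
  fixes n :: nat and B :: "nat \<Rightarrow> nat \<Rightarrow> real" and T c :: real
  assumes symm_B: "symm n B" and diag_B: "\<And>i. i < n \<Longrightarrow> B i i = 1"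
    and c_pos: "0 < c" and c_le_T: "c \<le> T"
    and upper_B: "\<And>x. quad n B x \<le> (T - c) * dotp n x x"
begin

definition H :: "nat \<Rightarrow> nat \<Rightarrow> nat \<Rightarrow> real" where
  "H i = inv_entry n (shifted T (clear_index i B))"

sublocale full: pos_def_matrix n "shifted T B" c
  by (rule pos_def_shifted[OF symm_B c_pos upper_B])

sublocale minor: pos_def_matrix n "shifted T (clear_index i B)" c for i
  using c_le_T
  by (intro pos_def_shifted symm_clear_index symm_B c_pos clear_index_upper_bound upper_B) auto

lemma T_pos: "0 < T" using c_pos c_le_T by simp

lemma symm_H: "symm n (H i)"
  unfolding H_def by (rule minor.symm_inverse)

text \<open>Row \<open>i\<close> of the shifted cleared matrix is \<open>T\<close> times a unit
  vector, so its equation forces this entry of the solution to vanish.\<close>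

lemma mulv_H_cleared:
  assumes "i < n" "x i = 0"
  shows "mulv n (H i) x i = 0"
proof -
  have "mulv n (shifted T (clear_index i B)) (mulv n (H i) x) i = 0"
    unfolding H_def using assms by (simp add: minor.mulv_inverse)
  moreover have "mulv n (shifted T (clear_index i B)) (mulv n (H i) x) i = T * mulv n (H i) x i"
    using assms(1) unfolding mulv_def[of n "shifted _ _"]
    by (simp add: shifted_def clear_index_def if_distrib[of "\<lambda>z. z * _"] cong: if_cong)
  ultimately show ?thesis using T_pos by simp
qed

lemma H_frobenius: "(\<Sum>k<n. \<Sum>l<n. (H i k l)\<^sup>2) \<le> real n / c\<^sup>2"
proof -
  have "(\<Sum>k<n. \<Sum>l<n. (H i k l)\<^sup>2) = (\<Sum>l<n. \<Sum>k<n. (H i k l)\<^sup>2)" by (rule sum.swap)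
  also have "\<dots> \<le> (\<Sum>l<n. 1 / c\<^sup>2)"
    using minor.inverse_col_norm c_pos
    by (intro sum_mono) (auto simp: H_def field_simps)
  finally show ?thesis by simp
qed

text \<open>The row sums form the image under \<open>H i\<close> of the all-ones vector, of squared
  norm \<open>n\<close>. They enter through the mean of the matrix entries.\<close>

lemma H_row_sums: "(\<Sum>k<n. (\<Sum>l<n. H i k l)\<^sup>2) \<le> real n / c\<^sup>2"
  using minor.mulv_inverse_norm[of i "\<lambda>_. 1"] c_pos
  by (simp add: dotp_def mulv_def H_def power2_eq_square field_simps)

text \<open>For \<open>k \<noteq> i\<close> the test vector is the \<open>k\<close>-th column of the inverse with its \<open>i\<close>-th entry cleared.\<close>

lemma H_diag_sum_lower:
  assumes "i < n"
  shows "(\<Sum>k<n. full.G k k) - 1 / c - T / c\<^sup>2 \<le> (\<Sum>k\<in>{..<n} - {i}. H i k k)"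
proof -
  have each: "full.G k k - T * (full.G k i)\<^sup>2 \<le> H i k k" if k: "k < n" "k \<noteq> i" for k
  proof -
    let ?g = "\<lambda>j. full.G j k"
    define x where "x = (\<lambda>j. ?g j + (- full.G i k) * unit i j)"
    have xi: "x i = 0" by (simp add: x_def unit_def)
    have xk: "x k = full.G k k" using k by (simp add: x_def unit_def)
    \<comment> \<open>The shifted matrix maps this column to \<open>unit k\<close>, which vanishes
      at \<open>i\<close>; hence there is no cross term.\<close>
    have g0: "dotp n (unit i) (mulv n (shifted T B) ?g) = 0"
      using assms k by (simp add: dotp_unit full.mulv_inverse_col) (simp add: unit_def)
    have "quad n (shifted T B) ?g = dotp n ?g (unit k)"
      unfolding quad_def using k by (intro dotp_cong) (auto simp: full.mulv_inverse_col)
    then have g1: "quad n (shifted T B) ?g = full.G k k"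
      using k by (simp add: dotp_comm[of n _ "unit k"] dotp_unit)
    have g2: "quad n (shifted T B) (unit i) = T - 1"
      unfolding quad_def using assms diag_B by (simp add: dotp_unit mulv_unit) (simp add: shifted_def)
    have "quad n (shifted T B) x = full.G k k + (full.G i k)\<^sup>2 * (T - 1)"
      unfolding x_def quad_add[OF full.symm] by (simp add: g0 g1 g2)
    moreover have "2 * x k - quad n (shifted T (clear_index i B)) x \<le> H i k k"
      unfolding H_def using k by (intro minor.inverse_diag_variational)
    moreover have sq: "(full.G i k)\<^sup>2 * (T - 1) \<le> T * (full.G k i)\<^sup>2"
      using full.symm_inverse assms k by (auto simp: symm_def algebra_simps)
    ultimately show ?thesis
      using xk quad_shifted_clear_index[of x i n T B, OF xi] sq by linarith
  qed
  have "(\<Sum>k\<in>{..<n} - {i}. full.G k k) - T * (\<Sum>k<n. (full.G k i)\<^sup>2)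
      \<le> (\<Sum>k\<in>{..<n} - {i}. full.G k k) - T * (\<Sum>k\<in>{..<n} - {i}. (full.G k i)\<^sup>2)"
    using T_pos by (intro diff_left_mono mult_left_mono sum_mono2) auto
  also have "\<dots> = (\<Sum>k\<in>{..<n} - {i}. full.G k k - T * (full.G k i)\<^sup>2)"
    by (simp add: sum_subtractf sum_distrib_left)
  also have "\<dots> \<le> (\<Sum>k\<in>{..<n} - {i}. H i k k)"
    by (intro sum_mono each) auto
  finally have 1: "(\<Sum>k\<in>{..<n} - {i}. full.G k k) - T * (\<Sum>k<n. (full.G k i)\<^sup>2) \<le> (\<Sum>k\<in>{..<n} - {i}. H i k k)" .
  \<comment> \<open>The two losses: the corrections add up to a squared column norm, at most
    \<open>1 / c\<^sup>2\<close>, and the omitted diagonal entry is at most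
    \<open>1 / c\<close>.\<close>
  have "T * (\<Sum>k<n. (full.G k i)\<^sup>2) \<le> T * (1 / c\<^sup>2)"
    using full.inverse_col_norm[OF assms] c_pos T_pos by (intro mult_left_mono) (auto simp: field_simps)
  moreover have "full.G i i \<le> 1 / c"
    using full.inverse_diag_le[OF assms] c_pos by (simp add: field_simps)
  moreover have "(\<Sum>k<n. full.G k k) = full.G i i + (\<Sum>k\<in>{..<n} - {i}. full.G k k)"
    using assms by (intro sum.remove) auto
  ultimately show ?thesis using 1 by simp
qed

end

section \<open>Row fluctuations and the averaged resolvent inequality\<close>

context entry_law
begin

text \<open>The fluctuation of the quadratic form of the centred row about \<open>var\<close> times
  the trace, plus a linear term caused by the mean of the row.\<close>

definition row_form :: "nat \<Rightarrow> real \<Rightarrow> (nat \<Rightarrow> nat \<Rightarrow> real) \<Rightarrow> nat \<Rightarrow> real" where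
  "row_form n T B i = centred_form ({..<n} - {i}) (inv_entry n (shifted T (clear_index i B)))
     (\<lambda>k. 2 * mean * (\<Sum>l<n. inv_entry n (shifted T (clear_index i B)) k l)) (B i)"

text \<open>The test vector is \<open>a (e\<^sub>i + H\<^sub>i \<xi>)\<close>, where \<open>\<xi>\<close> is the centred \<open>i\<close>-th row with the diagonal removed.\<close>

lemma resolvent_diag_lower:
  assumes "bounded_symm_matrix n B T c" "i < n"
  shows "2 * a - a\<^sup>2 * (T - 1 - var * (\<Sum>k\<in>{..<n} - {i}. inv_entry n (shifted T (clear_index i B)) k k)
      - row_form n T B i) \<le> inv_entry n (shifted T B) i i"
proof -
  interpret bounded_symm_matrix n B T c by fact
  define \<xi> where "\<xi> = (\<lambda>k. if k = i then 0 else B i k - mean)"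
  define y where "y = mulv n (H i) \<xi>"
  have xi: "\<xi> i = 0" by (simp add: \<xi>_def)
  have yi: "y i = 0" unfolding y_def using assms(2) xi by (rule mulv_H_cleared)
  define x where "x = (\<lambda>k. a * (unit i k + 1 * y k))"
  have q1: "quad n (shifted T B) (unit i) = T - 1"
    unfolding quad_def using assms(2) diag_B by (simp add: dotp_unit mulv_unit) (simp add: shifted_def)
  have q2: "quad n (shifted T B) y = quad n (H i) \<xi>"
  proof -
    have "quad n (shifted T B) y = quad n (shifted T (clear_index i B)) y"
      by (rule quad_shifted_clear_index[of y i, OF yi, symmetric])
    then show ?thesis unfolding y_def H_def by (simp only: minor.quad_mulv_inverse)
  qed
  have rs: "(\<Sum>k<n. y k) = (\<Sum>k<n. \<xi> k * (\<Sum>l<n. H i k l))"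
  proof -
    have "(\<Sum>k<n. y k) = dotp n (\<lambda>_. 1) (mulv n (H i) \<xi>)" by (simp add: y_def dotp_def)
    also have "\<dots> = dotp n \<xi> (mulv n (H i) (\<lambda>_. 1))" by (rule dotp_mulv_symm[OF symm_H])
    finally show ?thesis by (simp add: dotp_def mulv_def)
  qed
  \<comment> \<open>Off the diagonal, column \<open>i\<close> of the shifted matrix is minus the sum
    of \<open>mean\<close> and \<open>\<xi>\<close>. The \<open>mean\<close> part produces the row
    sums of \<open>H i\<close>, the other part its quadratic form.\<close>
  have q3: "dotp n y (mulv n (shifted T B) (unit i)) = - (mean * (\<Sum>k<n. \<xi> k * (\<Sum>l<n. H i k l)) + quad n (H i) \<xi>)"
  proof -
    have "dotp n y (mulv n (shifted T B) (unit i)) = (\<Sum>k<n. - (mean * y k + \<xi> k * y k))"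
      unfolding dotp_def
    proof (rule sum.cong)
      fix k assume k: "k \<in> {..<n}"
      show "y k * mulv n (shifted T B) (unit i) k = - (mean * y k + \<xi> k * y k)"
      proof (cases "k = i")
        case False
        then have "B k i = B i k" using k symm_B assms(2) by (auto simp: symm_def)
        then show ?thesis using False assms(2) by (simp add: mulv_unit shifted_def \<xi>_def algebra_simps)
      qed (simp add: yi)
    qed simp
    also have "\<dots> = - (mean * (\<Sum>k<n. y k) + dotp n \<xi> y)"
      by (simp add: dotp_def sum.distrib sum_negf sum_distrib_left sum_subtractf)
    finally show ?thesis unfolding rs by (simp add: y_def quad_def)
  qed
  have qx: "quad n (shifted T B) x = a\<^sup>2 * (T - 1 - (quad n (H i) \<xi> + 2 * mean * (\<Sum>k<n. \<xi> k * (\<Sum>l<n. H i k l))))"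
    unfolding x_def quad_scale quad_add[OF full.symm] q1 q2 q3 by (simp add: algebra_simps)
  have "2 * x i - quad n (shifted T B) x \<le> full.G i i"
    by (rule full.inverse_diag_variational[OF assms(2)])
  moreover have "x i = a" by (simp add: x_def yi unit_def)
  moreover have "quad n (H i) \<xi> + 2 * mean * (\<Sum>k<n. \<xi> k * (\<Sum>l<n. H i k l)) =
      var * (\<Sum>k\<in>{..<n} - {i}. H i k k) + row_form n T B i"
  proof -
    let ?S = "{..<n} - {i}"
    have r: "(\<Sum>k<n. f k) = (\<Sum>k\<in>?S. f k)" if "f i = 0" for f :: "nat \<Rightarrow> real"
      using assms(2) that by (subst sum.remove[of _ i]) auto
    have "quad n (H i) \<xi> = (\<Sum>k\<in>?S. \<Sum>l<n. H i k l * \<xi> k * \<xi> l)"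
      unfolding quad_double_sum by (rule r) (simp add: xi)
    also have "\<dots> = (\<Sum>k\<in>?S. \<Sum>l\<in>?S. H i k l * \<xi> k * \<xi> l)"
      by (intro sum.cong refl r) (simp add: xi)
    also have "\<dots> = (\<Sum>k\<in>?S. \<Sum>l\<in>?S. H i k l * (B i k - mean) * (B i l - mean))"
      by (intro sum.cong refl) (auto simp: \<xi>_def)
    finally have 1: "quad n (H i) \<xi> = (\<Sum>k\<in>?S. \<Sum>l\<in>?S. H i k l * (B i k - mean) * (B i l - mean))" .
    have "2 * mean * (\<Sum>k<n. \<xi> k * (\<Sum>l<n. H i k l)) = (\<Sum>k\<in>?S. 2 * mean * (\<xi> k * (\<Sum>l<n. H i k l)))"
      unfolding sum_distrib_left[of "2 * mean"] by (rule r) (simp add: xi)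
    also have "\<dots> = (\<Sum>k\<in>?S. (2 * mean * (\<Sum>l<n. H i k l)) * (B i k - mean))"
      by (intro sum.cong refl) (simp add: \<xi>_def)
    finally show ?thesis
      unfolding row_form_def centred_form_def 1 H_def[symmetric] by simp
  qed
  ultimately show ?thesis unfolding qx by (simp only: H_def) (simp only: diff_diff_eq add.assoc)
qed

text \<open>A deterministic inequality: all randomness sits in the squares of the row forms, so
  second moment bounds will suffice.\<close>

lemma row_forms_lower_bound:
  assumes "bounded_symm_matrix n B T c" "n > 0" "var > 0"
  shows "4 * var * real n \<le> (T + var * (1 / c + T / c\<^sup>2) + 1 + (\<Sum>i<n. (row_form n T B i)\<^sup>2) / real n)\<^sup>2"
proof -
  interpret bounded_symm_matrix n B T c by fact
  define \<tau> where "\<tau> = (\<Sum>i<n. full.G i i)"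
  define a where "a = \<tau> / real n"
  define R where "R = (\<Sum>i<n. (row_form n T B i)\<^sup>2)"
  define K where "K = 1 / c + T / c\<^sup>2"
  define X where "X = T + var * K + 1 + R / real n"
  have tau: "0 < \<tau>"
    unfolding \<tau>_def using assms(2) by (intro sum_pos full.inverse_diag_pos) auto
  have each: "2 * a - a\<^sup>2 * (T - var * (\<tau> - K) + (1 + (row_form n T B i)\<^sup>2)) \<le> full.G i i" if i: "i < n" for i
  proof -
    let ?h = "\<Sum>k\<in>{..<n} - {i}. H i k k"
    \<comment> \<open>Bounding the fluctuation by 1 plus its square leaves only sums of squares to
      estimate.\<close>
    have "- row_form n T B i \<le> 1 + (row_form n T B i)\<^sup>2"
      using zero_le_power2[of "row_form n T B i + 1 / 2"] by (simp add: power2_eq_square algebra_simps)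
    moreover have "var * (\<tau> - K) \<le> var * ?h"
      using H_diag_sum_lower[OF i] assms(3) by (intro mult_left_mono) (auto simp: \<tau>_def K_def)
    ultimately have "a\<^sup>2 * (T - 1 - var * ?h - row_form n T B i) \<le> a\<^sup>2 * (T - var * (\<tau> - K) + (1 + (row_form n T B i)\<^sup>2))"
      by (intro mult_left_mono) auto
    with resolvent_diag_lower[OF assms(1) i, of a] show ?thesis by (simp add: H_def)
  qed
  have "(\<Sum>i<n. 2 * a - a\<^sup>2 * (T - var * (\<tau> - K) + (1 + (row_form n T B i)\<^sup>2))) \<le> \<tau>"
    unfolding \<tau>_def using each by (intro sum_mono) (simp add: \<tau>_def)
  also have "(\<Sum>i<n. 2 * a - a\<^sup>2 * (T - var * (\<tau> - K) + (1 + (row_form n T B i)\<^sup>2)))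
     = real n * (2 * a) - a\<^sup>2 * (real n * (T - var * (\<tau> - K)) + (real n + R))"
    by (simp add: sum_subtractf sum.distrib R_def flip: sum_distrib_left)
  \<comment> \<open>With \<open>a = \<tau> / real n\<close> the linear terms add up to
    \<open>2 * \<tau>\<close>, and \<open>X\<close> collects everything in the bracket except
    \<open>- var * \<tau>\<close>.\<close>
  also have "\<dots> = 2 * \<tau> - \<tau> * \<tau> * (X - var * \<tau>) / real n"
    using assms(2) unfolding a_def X_def by (simp add: field_simps power2_eq_square)
  finally have "\<tau> * real n \<le> \<tau> * (\<tau> * (X - var * \<tau>))"
    using assms(2) by (simp add: field_simps)
  then have "real n \<le> \<tau> * (X - var * \<tau>)" using tau by simp
  then have "4 * var * real n \<le> 4 * var * (\<tau> * (X - var * \<tau>))" using assms(3) by simp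
  \<comment> \<open>Completing the square in \<open>\<tau>\<close> removes the unknown
    trace.\<close>
  also have "\<dots> \<le> X\<^sup>2"
    using zero_le_power2[of "X - 2 * var * \<tau>"] by (simp add: power2_eq_square algebra_simps)
  finally show ?thesis by (simp add: X_def K_def R_def)
qed

end

section \<open>Probability estimates\<close>

context prob_space
begin

text \<open>Markov's inequality. Negative values of \<open>f\<close> become 0 under
  \<open>ennreal\<close> and lie below the positive \<open>t\<close>, so they do no harm.\<close>

lemma prob_ge_le_of_nn_integral_le:
  assumes [measurable]: "f \<in> borel_measurable M" and "(\<integral>\<^sup>+x. ennreal (f x) \<partial>M) \<le> ennreal K" "0 < t" "0 \<le> K"
  shows "prob {x \<in> space M. t \<le> f x} \<le> K / t"
proof -
  have "emeasure M {x \<in> space M. 1 \<le> ennreal (1 / t) * ennreal (f x)} \<le> ennreal (1 / t) * (\<integral>\<^sup>+x. ennreal (f x) * indicator (space M) x \<partial>M)"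
    by (rule nn_integral_Markov_inequality) auto
  also have "(\<integral>\<^sup>+x. ennreal (f x) * indicator (space M) x \<partial>M) = (\<integral>\<^sup>+x. ennreal (f x) \<partial>M)"
    by (intro nn_integral_cong) simp
  also have "ennreal (1 / t) * \<dots> \<le> ennreal (1 / t) * ennreal K"
    by (intro mult_left_mono assms) simp
  also have "\<dots> = ennreal (K / t)" using assms by (simp flip: ennreal_mult)
  also have "{x \<in> space M. 1 \<le> ennreal (1 / t) * ennreal (f x)} = {x \<in> space M. t \<le> f x}"
  proof (intro Collect_cong conj_cong refl)
    fix x
    show "(1 \<le> ennreal (1 / t) * ennreal (f x)) \<longleftrightarrow> t \<le> f x"
    proof (cases "0 \<le> f x")
      case True
      then have "ennreal (1 / t) * ennreal (f x) = ennreal (f x / t)"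
        using assms(3) by (simp flip: ennreal_mult)
      then show ?thesis using assms(3) True by (simp add: ennreal_ge_1)
    next
      case False
      then show ?thesis using assms(3) by (simp add: ennreal_neg)
    qed
  qed
  finally show ?thesis using assms by (simp add: emeasure_eq_measure)
qed

end

text \<open>The coordinate of an unordered pair is addressed by minimum and maximum, which makes the
  matrix symmetric by construction.\<close>

definition entry :: "(nat \<times> nat \<Rightarrow> real) \<Rightarrow> nat \<Rightarrow> nat \<Rightarrow> real" where
  "entry w i j = (if i = j then 1 else w (min i j, max i j))"

lemma rand_mat_eq: "rand_mat n w = mat_of n (entry w)"
  unfolding rand_mat_def mat_of_def by (rule cong_mat) (auto simp: entry_def min_def max_def)

lemma symm_entry: "symm n (entry w)"
  by (auto simp: symm_def entry_def min.commute max.commute)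

lemma finite_upper_idx [simp]: "finite (upper_idx n)"
  by (rule finite_subset[of _ "{..<n} \<times> {..<n}"]) (auto simp: upper_idx_def)

lemma minmax_in_upper_idx: "i < n \<Longrightarrow> j < n \<Longrightarrow> i \<noteq> j \<Longrightarrow> (min i j, max i j) \<in> upper_idx n"
  by (auto simp: upper_idx_def)

lemma sum_entry: "(\<Sum>i<n. \<Sum>j<n. entry w i j) = real n + 2 * (\<Sum>u\<in>upper_idx n. w u)"
proof (induction n)
  case 0
  then show ?case by (simp add: upper_idx_def)
next
  case (Suc n)
  have U: "upper_idx (Suc n) = upper_idx n \<union> (\<lambda>i. (i, n)) ` {..<n}"
    by (auto simp: upper_idx_def less_Suc_eq)
  have "(\<Sum>u\<in>upper_idx (Suc n). w u) = (\<Sum>u\<in>upper_idx n. w u) + (\<Sum>i<n. w (i, n))"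
  proof -
    have "upper_idx n \<inter> (\<lambda>i. (i, n)) ` {..<n} = {}" by (auto simp: upper_idx_def)
    then show ?thesis unfolding U by (subst sum.union_disjoint) (auto simp: sum.reindex inj_on_def)
  qed
  moreover have "(\<Sum>i<n. entry w i n) = (\<Sum>i<n. w (i, n))" "(\<Sum>j<n. entry w n j) = (\<Sum>i<n. w (i, n))"
    by (auto simp: entry_def intro!: sum.cong)
  moreover have "entry w n n = 1" by (simp add: entry_def)
  ultimately show ?case using Suc.IH by (simp add: sum.distrib)
qed

text \<open>Comparing the entry sum \<open>n^2\<close> of the all-ones matrix with
  \<open>sum_entry\<close> counts the pairs.\<close>

lemma card_upper_idx: "2 * real (card (upper_idx n)) = real n * (real n - 1)"
proof -
  have "(\<Sum>i<n. \<Sum>j<n. entry (\<lambda>_. 1) i j) = real n * real n" by (simp add: entry_def)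
  then show ?thesis using sum_entry[of "\<lambda>_. 1" n] by (simp add: algebra_simps)
qed

text \<open>The Rayleigh quotient of the all-ones vector is the entry sum divided by
  \<open>n\<close>.\<close>

lemma mean_entry_le_lambda1:
  assumes "n > 0"
  shows "real n + 2 * (\<Sum>u\<in>upper_idx n. w u) \<le> real n * lambda1 (rand_mat n w)"
proof -
  have "quad n (entry w) (\<lambda>_. 1) \<le> lambda1 (mat_of n (entry w)) * dotp n (\<lambda>_. 1) (\<lambda>_. 1)"
    using lambda1_le_iff[OF symm_entry assms, of w "lambda1 (mat_of n (entry w))"] by blast
  then show ?thesis
    by (simp add: quad_double_sum sum_entry dotp_def rand_mat_eq mult.commute)
qed

section \<open>Tail bounds for matrices with independent entries of law \<open>\<mu>\<close>\<close>

context entry_law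
begin

abbreviation entries :: "nat \<Rightarrow> (nat \<times> nat \<Rightarrow> real) measure" where
  "entries n \<equiv> PiM (upper_idx n) (\<lambda>_. \<mu>)"

lemma measurable_entry: "i < n \<Longrightarrow> j < n \<Longrightarrow> (\<lambda>w. entry w i j) \<in> borel_measurable (entries n)"
  by (cases "i = j") (auto simp: entry_def intro!: measurable_coord minmax_in_upper_idx)

lemma measurable_lambda1:
  assumes "n > 0"
  shows "(\<lambda>w. lambda1 (rand_mat n w)) \<in> borel_measurable (entries n)"
  unfolding rand_mat_eq by (rule borel_measurable_lambda1[OF assms symm_entry measurable_entry])

lemma measurable_minor_inverse:
  assumes "k < n" "l < n"
  shows "(\<lambda>w. inv_entry n (shifted T (clear_index i (entry w))) k l) \<in> borel_measurable (entries n)"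
proof (rule borel_measurable_inv_entry[OF _ assms])
  fix k l assume kl: "k < n" "l < n"
  have "(\<lambda>w. clear_index i (entry w) k l) \<in> borel_measurable (entries n)"
    unfolding clear_index_def by (cases "k = i \<or> l = i") (simp_all only: if_True if_False borel_measurable_const measurable_entry[OF kl])
  then show "(\<lambda>w. shifted T (clear_index i (entry w)) k l) \<in> borel_measurable (entries n)"
    unfolding shifted_def by (intro borel_measurable_diff borel_measurable_const)
qed

text \<open>A measurable condition that depends only on the entries outside row \<open>i\<close> and holds whenever
  \<open>lambda1\<close> is small.\<close>

definition good_row :: "nat \<Rightarrow> real \<Rightarrow> real \<Rightarrow> (nat \<Rightarrow> nat \<Rightarrow> real) \<Rightarrow> nat \<Rightarrow> bool" where
  "good_row n T \<beta> B i \<longleftrightarrow> (let H = inv_entry n (shifted T (clear_index i B)); S = {..<n} - {i} in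
     (\<forall>k\<in>S. \<forall>l\<in>S. H k l = H l k) \<and>
     (\<Sum>k\<in>S. \<Sum>l\<in>S. (H k l)\<^sup>2) + (\<Sum>k\<in>S. (2 * mean * (\<Sum>l<n. H k l))\<^sup>2) \<le> \<beta>)"

text \<open>\<open>H_frobenius\<close> accounts for the summand 1 and \<open>H_row_sums\<close> for
  \<open>4 * mean\<^sup>2\<close>; restricting the sums to indices other than \<open>i\<close> only
  decreases them.\<close>

lemma good_rowI:
  assumes "bounded_symm_matrix n B T c" "(1 + 4 * mean\<^sup>2) * (real n / c\<^sup>2) \<le> \<beta>"
  shows "good_row n T \<beta> B i"
proof -
  interpret bounded_symm_matrix n B T c by fact
  let ?S = "{..<n} - {i}"
  have "(\<Sum>k\<in>?S. \<Sum>l\<in>?S. (H i k l)\<^sup>2) \<le> (\<Sum>k\<in>?S. \<Sum>l<n. (H i k l)\<^sup>2)"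
    by (intro sum_mono sum_mono2) auto
  also have "\<dots> \<le> (\<Sum>k<n. \<Sum>l<n. (H i k l)\<^sup>2)"
    by (intro sum_mono2) (auto intro: sum_nonneg)
  also note H_frobenius
  finally have 1: "(\<Sum>k\<in>?S. \<Sum>l\<in>?S. (H i k l)\<^sup>2) \<le> real n / c\<^sup>2" .
  have "(\<Sum>k\<in>?S. (2 * mean * (\<Sum>l<n. H i k l))\<^sup>2) \<le> (\<Sum>k<n. (2 * mean * (\<Sum>l<n. H i k l))\<^sup>2)"
    by (intro sum_mono2) auto
  also have "\<dots> = 4 * mean\<^sup>2 * (\<Sum>k<n. (\<Sum>l<n. H i k l)\<^sup>2)"
    unfolding sum_distrib_left[of "4 * mean\<^sup>2"] by (intro sum.cong refl) (simp add: power_mult_distrib)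
  also have "\<dots> \<le> 4 * mean\<^sup>2 * (real n / c\<^sup>2)"
    by (intro mult_left_mono H_row_sums) auto
  finally have 2: "(\<Sum>k\<in>?S. (2 * mean * (\<Sum>l<n. H i k l))\<^sup>2) \<le> 4 * mean\<^sup>2 * (real n / c\<^sup>2)" .
  show ?thesis
    using 1 2 assms(2) symm_H[of i]
    unfolding good_row_def Let_def H_def[symmetric] by (auto simp: symm_def algebra_simps)
qed

lemma row_index_inj: "inj_on (\<lambda>k. (min i k, max i k)) (S :: nat set)"
  by (auto simp: inj_on_def min_def max_def split: if_splits)

text \<open>The coefficients of the row form and the condition \<open>good_row\<close> depend only
  on entries outside row \<open>i\<close>, so the bound for random coefficients applies, with
  \<open>e\<close> listing the coordinates of row \<open>i\<close>.\<close>

lemma row_form_second_moment: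
  assumes "i < n" "0 \<le> \<beta>"
  shows "(\<integral>\<^sup>+w. ennreal (if good_row n T \<beta> (entry w) i then (row_form n T (entry w) i)\<^sup>2 else 0) \<partial>entries n)
     \<le> ennreal (qconst * \<beta>)"
    and "(\<lambda>w. if good_row n T \<beta> (entry w) i then (row_form n T (entry w) i)\<^sup>2 else 0) \<in> borel_measurable (entries n)"
proof -
  let ?S = "{..<n} - {i}"
  let ?e = "\<lambda>k. (min i k, max i k)"
  define H where "H = (\<lambda>w. inv_entry n (shifted T (clear_index i (entry w))))"
  define b where "b = (\<lambda>w k. 2 * mean * (\<Sum>l<n. H w k l))"
  have rf: "row_form n T (entry w) i = centred_form ?S (H w) (b w) (\<lambda>k. w (?e k))" for w
  proof -
    have "entry w i k = w (?e k)" if "k \<in> ?S" for k using that by (auto simp: entry_def)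
    then show ?thesis unfolding row_form_def centred_form_def H_def b_def by simp
  qed
  have mH: "(\<lambda>w. H w k l) \<in> borel_measurable (entries n)" if "k < n" "l < n" for k l
    unfolding H_def by (rule measurable_minor_inverse[OF that])
  have mb: "(\<lambda>w. b w k) \<in> borel_measurable (entries n)" if "k < n" for k
    unfolding b_def using that by (intro borel_measurable_times borel_measurable_const borel_measurable_sum mH) auto
  have gr: "good_row n T \<beta> (entry w) i \<longleftrightarrow> (\<forall>k\<in>?S. \<forall>l\<in>?S. H w k l = H w l k) \<and>
     (\<Sum>k\<in>?S. \<Sum>l\<in>?S. (H w k l)\<^sup>2) + (\<Sum>k\<in>?S. (b w k)\<^sup>2) \<le> \<beta>" for w
    unfolding good_row_def Let_def H_def b_def ..
  have mP: "Measurable.pred (entries n) (\<lambda>w. good_row n T \<beta> (entry w) i)"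
    unfolding gr
  proof (intro pred_intros_logic pred_intros_finite)
    have [measurable]: "(\<lambda>w. (\<Sum>k\<in>?S. \<Sum>l\<in>?S. (H w k l)\<^sup>2) + (\<Sum>k\<in>?S. (b w k)\<^sup>2)) \<in> borel_measurable (entries n)"
      by (intro borel_measurable_add borel_measurable_sum borel_measurable_power mH mb) auto
    show "Measurable.pred (entries n) (\<lambda>w. (\<Sum>k\<in>?S. \<Sum>l\<in>?S. (H w k l)\<^sup>2) + (\<Sum>k\<in>?S. (b w k)\<^sup>2) \<le> \<beta>)"
      by measurable
  next
    fix k l assume "k \<in> ?S" "l \<in> ?S"
    then have [measurable]: "(\<lambda>w. H w k l) \<in> borel_measurable (entries n)" "(\<lambda>w. H w l k) \<in> borel_measurable (entries n)"
      by (auto intro: mH)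
    show "Measurable.pred (entries n) (\<lambda>w. H w k l = H w l k)"
      unfolding pred_def by (intro borel_measurable_eq) auto
  qed auto
  have sub: "?e ` ?S \<subseteq> upper_idx n"
    using assms(1) by (auto simp: upper_idx_def min_def max_def)
  show "(\<integral>\<^sup>+w. ennreal (if good_row n T \<beta> (entry w) i then (row_form n T (entry w) i)\<^sup>2 else 0) \<partial>entries n)
     \<le> ennreal (qconst * \<beta>)"
    unfolding rf
  proof (rule centred_form_second_moment_random)
    fix w w' :: "nat \<times> nat \<Rightarrow> real"
    assume eq: "\<And>u. u \<in> upper_idx n - ?e ` ?S \<Longrightarrow> w u = w' u"
    \<comment> \<open>An entry that is neither cleared nor diagonal belongs to a pair avoiding
      \<open>i\<close>, hence to a coordinate outside row \<open>i\<close>.\<close>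
    have "clear_index i (entry w) k l = clear_index i (entry w') k l" if "k < n" "l < n" for k l
    proof (cases "k = i \<or> l = i \<or> k = l")
      case False
      then have "(min k l, max k l) \<in> upper_idx n - ?e ` ?S"
        using that minmax_in_upper_idx[of k n l] by (auto simp: min_def max_def split: if_splits)
      then show ?thesis using eq by (auto simp: clear_index_def entry_def)
    qed (auto simp: clear_index_def entry_def)
    then have "mat_of n (shifted T (clear_index i (entry w))) = mat_of n (shifted T (clear_index i (entry w')))"
      unfolding mat_of_def by (intro cong_mat) (auto simp: shifted_def)
    then have H: "H w = H w'" by (intro ext) (simp add: H_def inv_entry_def)
    then have b: "b w = b w'" by (simp add: b_def)
    show "good_row n T \<beta> (entry w) i = good_row n T \<beta> (entry w') i \<and> H w = H w' \<and> b w = b w'"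
      unfolding gr H b by simp
  qed (use sub row_index_inj mP mH mb assms gr in auto)
  show "(\<lambda>w. if good_row n T \<beta> (entry w) i then (row_form n T (entry w) i)\<^sup>2 else 0) \<in> borel_measurable (entries n)"
    unfolding rf
  proof (intro measurable_If borel_measurable_power measurable_centred_form sub)
    show "{w \<in> space (entries n). good_row n T \<beta> (entry w) i} \<in> sets (entries n)"
      using mP by (simp add: pred_def)
  qed (auto intro: mH mb)
qed

text \<open>A small \<open>lambda1\<close> forces the sum of the \<open>N\<close> independent
  entries to at most half of its expectation \<open>mean * N\<close>; Chebyshev's inequality bounds
  the probability of this deviation.\<close>

lemma prob_lambda1_small_positive_mean:
  assumes "mean > 0" "n > 1" "4 * sqrt (real n) \<le> mean * (real n - 1)"
  shows "measure (entries n) {w \<in> space (entries n). lambda1 (rand_mat n w) < 2 * sqrt (real n)}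
    \<le> 16 * var / (mean\<^sup>2 * (real n * (real n - 1)))"
proof -
  interpret E: prob_space "entries n" by (rule prob_space_PiM_law)
  define N where "N = real (card (upper_idx n))"
  define Z where "Z = (\<lambda>w. \<Sum>u\<in>upper_idx n. (w u - mean))"
  have N: "2 * N = real n * (real n - 1)" unfolding N_def by (rule card_upper_idx)
  have Np: "N > 0" using N assms(2) by (smt (verit) mult_pos_pos of_nat_1 of_nat_less_iff)
  have mZ[measurable]: "Z \<in> borel_measurable (entries n)"
    unfolding Z_def by (intro borel_measurable_sum borel_measurable_diff borel_measurable_const measurable_coord)
  have "(\<integral>\<^sup>+w. ennreal ((Z w)\<^sup>2) \<partial>entries n) \<le> ennreal (2 * var * N)"
    using linear_second_moment[of "upper_idx n" id 0 "\<lambda>_. 1"] by (simp add: Z_def N_def)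
  then have "E.prob {w \<in> space (entries n). mean\<^sup>2 * N\<^sup>2 / 4 \<le> (Z w)\<^sup>2} \<le> 2 * var * N / (mean\<^sup>2 * N\<^sup>2 / 4)"
    using assms(1) Np var_nonneg by (intro E.prob_ge_le_of_nn_integral_le) auto
  also have "\<dots> = 16 * var / (mean\<^sup>2 * (2 * N))"
    using Np assms(1) by (simp add: field_simps power2_eq_square)
  finally have 1: "E.prob {w \<in> space (entries n). mean\<^sup>2 * N\<^sup>2 / 4 \<le> (Z w)\<^sup>2} \<le> 16 * var / (mean\<^sup>2 * (real n * (real n - 1)))"
    by (simp add: N)
  have "{w \<in> space (entries n). lambda1 (rand_mat n w) < 2 * sqrt (real n)} \<subseteq> {w \<in> space (entries n). mean\<^sup>2 * N\<^sup>2 / 4 \<le> (Z w)\<^sup>2}"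
  proof safe
    fix w assume l: "lambda1 (rand_mat n w) < 2 * sqrt (real n)"
    have "real n + 2 * (\<Sum>u\<in>upper_idx n. w u) \<le> real n * lambda1 (rand_mat n w)"
      using assms(2) by (intro mean_entry_le_lambda1) simp
    also have "\<dots> \<le> real n * (2 * sqrt (real n))" using l by (intro mult_left_mono) auto
    also have "\<dots> \<le> real n * (mean * (real n - 1) / 2)" using assms(3) by (intro mult_left_mono) auto
    also have "\<dots> = mean * (2 * N) / 2" unfolding N by simp
    also have "\<dots> = mean * N" by simp
    finally have "2 * (\<Sum>u\<in>upper_idx n. w u) \<le> mean * N" by simp
    moreover have "Z w = (\<Sum>u\<in>upper_idx n. w u) - mean * N"
      by (simp add: Z_def N_def sum_subtractf)
    ultimately have "mean * N / 2 \<le> - Z w" by linarith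
    then have "(mean * N / 2)\<^sup>2 \<le> (- Z w)\<^sup>2"
      using assms(1) Np by (intro power_mono) auto
    then show "mean\<^sup>2 * N\<^sup>2 / 4 \<le> (Z w)\<^sup>2" by (simp add: power_divide power_mult_distrib)
  qed
  then have "E.prob {w \<in> space (entries n). lambda1 (rand_mat n w) < 2 * sqrt (real n)} \<le>
     E.prob {w \<in> space (entries n). mean\<^sup>2 * N\<^sup>2 / 4 \<le> (Z w)\<^sup>2}"
    by (intro E.finite_measure_mono) auto
  with 1 show ?thesis by simp
qed

text \<open>The gap between \<open>T\<close> and \<open>2 * r\<close> is
  \<open>\<epsilon> / 2 * r\<close>. Half of it covers the deterministic error by
  \<open>large\<close>; a small \<open>lambda1\<close> then makes the average squared row form at
  least the other half, which Markov's inequality shows to be unlikely.\<close>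

lemma prob_lambda1_small_large_variance:
  assumes "var \<ge> 1" "0 < \<epsilon>" "\<epsilon> \<le> 1" "n > 0"
    and large: "var * (2 / \<epsilon> + 8 / \<epsilon>\<^sup>2) / sqrt (real n) + 1 < \<epsilon> / 4 * sqrt (real n)"
  shows "measure (entries n) {w \<in> space (entries n). lambda1 (rand_mat n w) < (2 - \<epsilon>) * sqrt (real n)}
    \<le> qconst * ((1 + 4 * mean\<^sup>2) * (4 / \<epsilon>\<^sup>2)) / (\<epsilon> / 4 * sqrt (real n))"
proof -
  interpret E: prob_space "entries n" by (rule prob_space_PiM_law)
  define r where "r = sqrt (real n)"
  have r: "r > 0" "r\<^sup>2 = real n" using assms(4) by (auto simp: r_def)
  \<comment> \<open>\<open>T\<close> and \<open>c\<close> are chosen so that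
    \<open>T - c = (2 - \<epsilon>) * r\<close> is the assumed bound on \<open>lambda1\<close>,
    while \<open>real n / c\<^sup>2\<close> does not depend on \<open>n\<close>.\<close>
  define T where "T = (2 - \<epsilon> / 2) * r"
  define c where "c = \<epsilon> / 2 * r"
  define \<beta> where "\<beta> = (1 + 4 * mean\<^sup>2) * (4 / \<epsilon>\<^sup>2)"
  \<comment> \<open>Restriction to good rows makes the expectation controllable; on the event
    considered every row is good, so nothing is lost there.\<close>
  define R where "R = (\<lambda>w. \<Sum>i<n. if good_row n T \<beta> (entry w) i then (row_form n T (entry w) i)\<^sup>2 else 0)"
  have beta: "\<beta> \<ge> 0" by (simp add: \<beta>_def)
  have mR[measurable]: "R \<in> borel_measurable (entries n)"
    unfolding R_def by (intro borel_measurable_sum row_form_second_moment(2) beta) auto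
  have "(\<integral>\<^sup>+w. ennreal (R w) \<partial>entries n) = (\<Sum>i<n. \<integral>\<^sup>+w. ennreal (if good_row n T \<beta> (entry w) i then (row_form n T (entry w) i)\<^sup>2 else 0) \<partial>entries n)"
    unfolding R_def
    by (subst nn_integral_sum[symmetric])
      (auto simp: sum_ennreal[symmetric] simp del: sum_ennreal intro!: row_form_second_moment(2) beta)
  also have "\<dots> \<le> (\<Sum>i<n. ennreal (qconst * \<beta>))"
    by (intro sum_mono row_form_second_moment(1) beta) auto
  also have "\<dots> = ennreal (real n * (qconst * \<beta>))"
    using qconst_nonneg beta by (simp add: ennreal_of_nat_eq_real_of_nat ennreal_mult)
  finally have "E.prob {w \<in> space (entries n). real n * (\<epsilon> / 4 * r) \<le> R w} \<le> real n * (qconst * \<beta>) / (real n * (\<epsilon> / 4 * r))"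
    using assms r qconst_nonneg beta by (intro E.prob_ge_le_of_nn_integral_le) auto
  also have "\<dots> = qconst * \<beta> / (\<epsilon> / 4 * r)" using assms(4) by (intro mult_divide_mult_cancel_left) auto
  finally have 1: "E.prob {w \<in> space (entries n). real n * (\<epsilon> / 4 * r) \<le> R w} \<le> qconst * \<beta> / (\<epsilon> / 4 * r)" .
  have "{w \<in> space (entries n). lambda1 (rand_mat n w) < (2 - \<epsilon>) * r} \<subseteq> {w \<in> space (entries n). real n * (\<epsilon> / 4 * r) \<le> R w}"
  proof safe
    fix w assume l: "lambda1 (rand_mat n w) < (2 - \<epsilon>) * r"
    show "real n * (\<epsilon> / 4 * r) \<le> R w"
    proof (rule ccontr)
      assume "\<not> real n * (\<epsilon> / 4 * r) \<le> R w"
      then have Rs: "R w / real n < \<epsilon> / 4 * r" using assms(4) by (simp add: field_simps)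
      have B: "bounded_symm_matrix n (entry w) T c"
      proof
        have Tc: "T - c = (2 - \<epsilon>) * r" by (simp add: T_def c_def algebra_simps)
        show "quad n (entry w) x \<le> (T - c) * dotp n x x" for x
          using l lambda1_le_iff[OF symm_entry assms(4), of w "T - c"] by (simp add: rand_mat_eq Tc)
        show "c \<le> T" unfolding T_def c_def using r assms(3) by (intro mult_right_mono) auto
      qed (use symm_entry assms r in \<open>auto simp: entry_def c_def\<close>)
      have c2: "real n / c\<^sup>2 = 4 / \<epsilon>\<^sup>2"
        using r assms(2) by (simp add: c_def power_mult_distrib power_divide flip: r(2))
      have "good_row n T \<beta> (entry w) i" for i
        by (rule good_rowI[OF B]) (simp add: \<beta>_def c2)
      then have Req: "R w = (\<Sum>i<n. (row_form n T (entry w) i)\<^sup>2)" by (simp add: R_def)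
      have K: "1 / c + T / c\<^sup>2 \<le> (2 / \<epsilon> + 8 / \<epsilon>\<^sup>2) / r"
      proof -
        have "1 / c = 2 / \<epsilon> / r" by (simp add: c_def)
        moreover have "T / c\<^sup>2 = (2 - \<epsilon> / 2) * (4 / \<epsilon>\<^sup>2) / r"
          using r(1) assms(2) by (simp add: c_def T_def power2_eq_square)
        moreover have "(2 - \<epsilon> / 2) * (4 / \<epsilon>\<^sup>2) / r \<le> 2 * (4 / \<epsilon>\<^sup>2) / r"
          using r assms(2) by (intro divide_right_mono mult_right_mono) auto
        ultimately show ?thesis by (simp add: add_divide_distrib)
      qed
      define X where "X = T + var * (1 / c + T / c\<^sup>2) + 1 + R w / real n"
      have "var * (1 / c + T / c\<^sup>2) \<le> var * ((2 / \<epsilon> + 8 / \<epsilon>\<^sup>2) / r)"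
        using K assms(1) by (intro mult_left_mono) auto
      moreover have "var * ((2 / \<epsilon> + 8 / \<epsilon>\<^sup>2) / r) + 1 < \<epsilon> / 4 * r"
        using large by (simp add: r_def)
      ultimately have "X < T + \<epsilon> / 4 * r + \<epsilon> / 4 * r"
        using Rs unfolding X_def by linarith
      then have Xu: "X < 2 * r" by (simp add: T_def algebra_simps)
      have "T \<ge> 0" using r assms(3) by (simp add: T_def)
      moreover have "R w \<ge> 0" unfolding R_def by (intro sum_nonneg) auto
      moreover have "c > 0" using r assms(2) by (simp add: c_def)
      ultimately have "X \<ge> 0" unfolding X_def using assms(1) by (intro add_nonneg_nonneg mult_nonneg_nonneg) auto
      then have "X\<^sup>2 < (2 * r)\<^sup>2" using Xu by (intro power_strict_mono) auto
      \<comment> \<open>Here \<open>var \<ge> 1\<close> yields the constant 2 in the final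
        bound.\<close>
      also have "\<dots> \<le> 4 * var * real n" using assms(1,4) by (simp add: power_mult_distrib r(2))
      also have "\<dots> \<le> X\<^sup>2"
        unfolding X_def Req using assms by (intro row_forms_lower_bound B) auto
      finally show False by simp
    qed
  qed
  then have "E.prob {w \<in> space (entries n). lambda1 (rand_mat n w) < (2 - \<epsilon>) * r} \<le>
     E.prob {w \<in> space (entries n). real n * (\<epsilon> / 4 * r) \<le> R w}"
    by (intro E.finite_measure_mono) auto
  with 1 show ?thesis by (simp add: r_def \<beta>_def)
qed

text \<open>Passing to the complement, it suffices to bound the probability of a small
  \<open>lambda1\<close> by a null sequence; the two alternatives are the two preceding tail
  bounds.\<close>

lemma lambda1_lower_bound_whp:
  assumes "mean > 0 \<or> var \<ge> 1" "\<epsilon> > 0"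
  shows "(\<lambda>n. measure (entries n) {w \<in> space (entries n). lambda1 (rand_mat n w) \<ge> (2 - \<epsilon>) * sqrt (real n)})
    \<longlonglongrightarrow> 1"
proof -
  define bad where "bad = (\<lambda>n. measure (entries n) {w \<in> space (entries n). lambda1 (rand_mat n w) < (2 - \<epsilon>) * sqrt (real n)})"
  have prob: "measure (entries n) {w \<in> space (entries n). lambda1 (rand_mat n w) \<ge> (2 - \<epsilon>) * sqrt (real n)} = 1 - bad n"
    if "n > 0" for n
  proof -
    interpret E: prob_space "entries n" by (rule prob_space_PiM_law)
    have [measurable]: "(\<lambda>w. lambda1 (rand_mat n w)) \<in> borel_measurable (entries n)"
      by (rule measurable_lambda1[OF that])
    have "{w \<in> space (entries n). lambda1 (rand_mat n w) \<ge> (2 - \<epsilon>) * sqrt (real n)} =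
       space (entries n) - {w \<in> space (entries n). lambda1 (rand_mat n w) < (2 - \<epsilon>) * sqrt (real n)}"
      by auto
    then show ?thesis unfolding bad_def by (simp add: E.prob_compl)
  qed
  \<comment> \<open>Replacing \<open>\<epsilon>\<close> by a smaller \<open>\<delta>\<close> only
    enlarges the bad event. It is used with 0 for positive mean and with
    \<open>min \<epsilon> 1\<close> for large variance, where the tail bound asks for a value up to
    1.\<close>
  have mono: "bad n \<le> measure (entries n) {w \<in> space (entries n). lambda1 (rand_mat n w) < (2 - \<delta>) * sqrt (real n)}"
    if "n > 0" "\<delta> \<le> \<epsilon>" for n \<delta>
  proof -
    interpret E: prob_space "entries n" by (rule prob_space_PiM_law)
    have [measurable]: "(\<lambda>w. lambda1 (rand_mat n w)) \<in> borel_measurable (entries n)"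
      by (rule measurable_lambda1[OF that(1)])
    have "(2 - \<epsilon>) * sqrt (real n) \<le> (2 - \<delta>) * sqrt (real n)" using that by (intro mult_right_mono) auto
    then show ?thesis unfolding bad_def by (intro E.finite_measure_mono) (auto intro: less_le_trans)
  qed
  have "\<exists>g. (\<forall>\<^sub>F n in sequentially. bad n \<le> g n) \<and> g \<longlonglongrightarrow> 0"
    using assms(1)
  proof
    assume m: "mean > 0"
    let ?g = "\<lambda>n. 16 * var / (mean\<^sup>2 * (real n * (real n - 1)))"
    have "\<forall>\<^sub>F n in sequentially. 4 * sqrt (real n) \<le> mean * (real n - 1)"
      using m by real_asymp
    then have "\<forall>\<^sub>F n in sequentially. bad n \<le> ?g n"
      using eventually_gt_at_top[of 1]
    proof eventually_elim
      case (elim n)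
      then show ?case
        using mono[of n 0] prob_lambda1_small_positive_mean[OF m, of n] assms(2) by simp
    qed
    moreover have "?g \<longlonglongrightarrow> 0" using m by real_asymp
    ultimately show ?thesis by (intro exI[of _ ?g] conjI)
  next
    assume v: "var \<ge> 1"
    define \<delta> where "\<delta> = min \<epsilon> 1"
    have d: "0 < \<delta>" "\<delta> \<le> 1" "\<delta> \<le> \<epsilon>" using assms(2) by (auto simp: \<delta>_def)
    let ?g = "\<lambda>n. qconst * ((1 + 4 * mean\<^sup>2) * (4 / \<delta>\<^sup>2)) / (\<delta> / 4 * sqrt (real n))"
    have "\<forall>\<^sub>F n in sequentially. var * (2 / \<delta> + 8 / \<delta>\<^sup>2) / sqrt (real n) + 1 < \<delta> / 4 * sqrt (real n)"
      using d by real_asymp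
    then have "\<forall>\<^sub>F n in sequentially. bad n \<le> ?g n"
      using eventually_gt_at_top[of 0]
    proof eventually_elim
      case (elim n)
      then show ?case
        using order_trans[OF mono[of n \<delta>] prob_lambda1_small_large_variance[OF v, of \<delta> n]] d by simp
    qed
    moreover have "?g \<longlonglongrightarrow> 0" using d by real_asymp
    ultimately show ?thesis by (intro exI[of _ ?g] conjI)
  qed
  then obtain g where g: "\<forall>\<^sub>F n in sequentially. bad n \<le> g n" "g \<longlonglongrightarrow> 0" by blast
  have "bad \<longlonglongrightarrow> 0"
    by (rule tendsto_sandwich[OF _ g(1) tendsto_const g(2)]) (simp add: bad_def)
  then have "(\<lambda>n. 1 - bad n) \<longlonglongrightarrow> 1 - 0" by (intro tendsto_intros)
  moreover have "\<forall>\<^sub>F n in sequentially. 1 - bad n =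
      measure (entries n) {w \<in> space (entries n). lambda1 (rand_mat n w) \<ge> (2 - \<epsilon>) * sqrt (real n)}"
    using eventually_gt_at_top[of 0] by eventually_elim (simp add: prob)
  ultimately show ?thesis by (simp add: tendsto_cong)
qed

end

section \<open>Moments of the entry distribution\<close>

context
  fixes D :: "real measure"
  assumes prob_D: "prob_space D" and sets_D: "sets D = sets borel"
begin

interpretation D: prob_space D by (rule prob_D)

lemma entry_kernel_measurable:
  "(\<lambda>b. if b then return D 1 else D) \<in> measurable (measure_pmf (bernoulli_pmf (1/2))) (subprob_algebra borel)"
proof -
  have "prob_space (return D 1)"
    using sets_eq_imp_space_eq[OF sets_D] by (intro prob_space_return) simp
  then show ?thesis
    using sets_D prob_D by (auto simp: space_subprob_algebra prob_space_imp_subprob_space)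
qed

lemma sets_entry_dist: "sets (entry_dist D) = sets borel"
  unfolding entry_dist_def using sets_D by (intro sets_bind) auto

text \<open>Conditioning on the fair coin averages the value at 1 with the integral over
  \<open>D\<close>.\<close>

lemma nn_integral_entry_dist:
  assumes f: "f \<in> borel_measurable borel"
  shows "(\<integral>\<^sup>+x. f x \<partial>entry_dist D) = (f 1 + (\<integral>\<^sup>+x. f x \<partial>D)) / 2"
proof -
  have fD: "f \<in> borel_measurable D" using f sets_D by (simp cong: measurable_cong_sets)
  have "(\<integral>\<^sup>+x. f x \<partial>entry_dist D) = (\<integral>\<^sup>+b. (\<integral>\<^sup>+x. f x \<partial>(if b then return D 1 else D)) \<partial>measure_pmf (bernoulli_pmf (1/2)))"
    unfolding entry_dist_def by (rule nn_integral_bind[OF f entry_kernel_measurable])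
  also have "\<dots> = f 1 * ennreal (1/2) + (\<integral>\<^sup>+x. f x \<partial>D) * ennreal (1/2)"
    using fD sets_eq_imp_space_eq[OF sets_D]
    by (subst nn_integral_bernoulli_pmf) (auto simp: nn_integral_return)
  also have "\<dots> = (f 1 + (\<integral>\<^sup>+x. f x \<partial>D)) / 2"
    by (simp add: divide_ennreal_def distrib_right ennreal_numeral flip: inverse_ennreal)
  finally show ?thesis .
qed

lemma prob_space_entry_dist: "prob_space (entry_dist D)"
proof
  have "emeasure (entry_dist D) (space (entry_dist D)) = (\<integral>\<^sup>+x. 1 \<partial>entry_dist D)" by simp
  also have "\<dots> = (1 + 1) / 2" by (subst nn_integral_entry_dist) (auto simp: D.emeasure_space_1)
  also have "\<dots> = 1" by (simp add: ennreal_divide_self flip: one_add_one)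
  finally show "emeasure (entry_dist D) (space (entry_dist D)) = 1" .
qed

text \<open>The identity for nonnegative integrals gives integrability through the absolute value,
  and the signed integral through positive and negative parts.\<close>

lemma has_integral_entry_dist:
  fixes f :: "real \<Rightarrow> real"
  assumes "integrable D f"
  shows "integrable (entry_dist D) f" and "(\<integral>x. f x \<partial>entry_dist D) = (f 1 + (\<integral>x. f x \<partial>D)) / 2"
proof -
  have f: "f \<in> borel_measurable borel"
    using borel_measurable_integrable[OF assms] sets_D by (simp cong: measurable_cong_sets)
  have half: "(\<integral>\<^sup>+x. ennreal (g x) \<partial>entry_dist D) = ennreal ((g 1 + (\<integral>x. g x \<partial>D)) / 2)"
    if "integrable D g" "\<And>x. 0 \<le> g x" for g :: "real \<Rightarrow> real"
  proof -
    have g: "g \<in> borel_measurable borel"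
      using borel_measurable_integrable[OF that(1)] sets_D by (simp cong: measurable_cong_sets)
    have "(\<integral>\<^sup>+x. ennreal (g x) \<partial>entry_dist D) = (ennreal (g 1) + ennreal (\<integral>x. g x \<partial>D)) / 2"
      using g that by (subst nn_integral_entry_dist) (auto simp: nn_integral_eq_integral)
    also have "\<dots> = ennreal ((g 1 + (\<integral>x. g x \<partial>D)) / 2)"
      using that by (simp add: divide_ennreal[symmetric] ennreal_plus)
    finally show ?thesis .
  qed
  have fE: "f \<in> borel_measurable (entry_dist D)"
    using f sets_entry_dist by (simp cong: measurable_cong_sets)
  show int: "integrable (entry_dist D) f"
    using half[of "\<lambda>x. \<bar>f x\<bar>"] assms fE by (intro integrableI_bounded) auto
  define p where "p = (\<lambda>x. max 0 (f x))"
  define q where "q = (\<lambda>x. max 0 (- f x))"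
  have pD: "integrable D p" "integrable D q" using assms by (auto simp: p_def q_def)
  have pE: "integrable (entry_dist D) p" "integrable (entry_dist D) q" using int by (auto simp: p_def q_def)
  have nn: "0 \<le> p x" "0 \<le> q x" for x by (auto simp: p_def q_def)
  have P: "(\<integral>x. p x \<partial>entry_dist D) = (p 1 + (\<integral>x. p x \<partial>D)) / 2"
    using half[OF pD(1) nn(1)] nn_integral_eq_integral[OF pE(1)] nn(1)
    by (simp add: integral_nonneg_AE)
  have Q: "(\<integral>x. q x \<partial>entry_dist D) = (q 1 + (\<integral>x. q x \<partial>D)) / 2"
    using half[OF pD(2) nn(2)] nn_integral_eq_integral[OF pE(2)] nn(2)
    by (simp add: integral_nonneg_AE)
  have fpq: "f = (\<lambda>x. p x - q x)" by (auto simp: p_def q_def max_def)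
  have e: "(\<integral>x. f x \<partial>entry_dist D) = (\<integral>x. p x \<partial>entry_dist D) - (\<integral>x. q x \<partial>entry_dist D)"
    "(\<integral>x. f x \<partial>D) = (\<integral>x. p x \<partial>D) - (\<integral>x. q x \<partial>D)"
    unfolding fpq using pE pD by (simp_all only: Bochner_Integration.integral_diff)
  have f1: "f 1 = p 1 - q 1" by (simp add: p_def q_def)
  show "(\<integral>x. f x \<partial>entry_dist D) = (f 1 + (\<integral>x. f x \<partial>D)) / 2"
    using e P Q f1 by argo
qed

lemma entry_law_entry_dist:
  assumes "integrable D (\<lambda>x. \<bar>x\<bar> ^ 5)"
  shows "entry_law (entry_dist D)"
proof -
  have "integrable D (\<lambda>x. x ^ 4)"
    by (rule integrable_lower_power[OF D.finite_measure_axioms sets_D assms]) simp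
  then show ?thesis
    using prob_space_entry_dist sets_entry_dist has_integral_entry_dist(1)
    by (simp add: entry_law_def entry_law_axioms_def)
qed

end

theorem theoremA5:
  fixes D :: "real measure" and \<phi> \<psi> :: real
  assumes "prob_space D"
    and "sets D = sets borel"
    and "integrable D (\<lambda>x. \<bar>x\<bar> ^ 5)"
    and "integrable D (\<lambda>x. x)" and "(\<integral>x. x \<partial>D) = \<phi>"
    and "\<psi> \<ge> 0" and "(\<integral>x. (x - \<phi>)\<^sup>2 \<partial>D) = \<psi>\<^sup>2"
  shows "\<forall>\<epsilon>>0. (\<lambda>n. measure (entries_space D n)
            {\<omega> \<in> space (entries_space D n). lambda1 (rand_mat n \<omega>) \<ge> (2 - \<epsilon>) * sqrt (real n)})
          \<longlonglongrightarrow> 1"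
proof -
  interpret D: prob_space D by fact
  interpret L: entry_law "entry_dist D" by (rule entry_law_entry_dist[OF assms(1,2,3)])
  note I = has_integral_entry_dist[OF assms(1,2)]
  have mean: "L.mean = (1 + \<phi>) / 2"
    unfolding L.mean_def using I(2)[OF assms(4)] assms(5) by simp
  have int2: "integrable D (\<lambda>x. (x - \<phi>)\<^sup>2)"
    using integrable_lower_power[OF D.finite_measure_axioms assms(2,3), of 2] assms(4) by (simp add: power2_diff)
  \<comment> \<open>If \<open>\<phi> > -1\<close> the mean is positive; otherwise
    \<open>(1 - \<phi>) / 2 \<ge> 1\<close>, and its square already makes the variance at least
    1.\<close>
  have "L.mean > 0 \<or> L.var \<ge> 1"
  proof (cases "\<phi> > -1")
    case False
    define m where "m = L.mean"
    \<comment> \<open>Recentring at \<open>\<phi>\<close>, the mean of \<open>D\<close>, makes the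
      linear term integrate to zero.\<close>
    have eq: "(\<lambda>x. (x - m)\<^sup>2) = (\<lambda>x. (x - \<phi>)\<^sup>2 + (2 * (\<phi> - m) * (x - \<phi>) + (\<phi> - m)\<^sup>2))"
      by (rule ext) (simp add: power2_eq_square algebra_simps)
    have intm: "integrable D (\<lambda>x. (x - m)\<^sup>2)"
      unfolding eq using int2 assms(4) by simp
    have "(\<integral>x. (x - m)\<^sup>2 \<partial>D) = \<psi>\<^sup>2 + (\<phi> - m)\<^sup>2"
      unfolding eq using int2 assms(4,5,7) by (simp add: D.prob_space)
    then have "L.var = ((1 - m)\<^sup>2 + (\<psi>\<^sup>2 + (\<phi> - m)\<^sup>2)) / 2"
      unfolding L.var_def m_def[symmetric] using I(2)[OF intm] by simp
    \<comment> \<open>Since \<open>m\<close> is the midpoint of 1 and \<open>\<phi>\<close>, both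
      squared distances equal \<open>((1 - \<phi>) / 2)\<^sup>2\<close>.\<close>
    also have "\<dots> = \<psi>\<^sup>2 / 2 + ((1 - \<phi>) / 2)\<^sup>2"
      unfolding m_def mean by (simp add: power2_eq_square field_simps)
    finally have "L.var = \<psi>\<^sup>2 / 2 + ((1 - \<phi>) / 2)\<^sup>2" .
    moreover have "1\<^sup>2 \<le> ((1 - \<phi>) / 2)\<^sup>2" using False by (intro power_mono) auto
    ultimately have "L.var \<ge> 1" using zero_le_power2[of \<psi>] by (simp only: one_power2)
    then show ?thesis ..
  qed (simp add: mean)
  then show ?thesis
    unfolding entries_space_def by (intro allI impI L.lambda1_lower_bound_whp)
qed

end
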